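(* Let $k$ be a field of characteristic zero and let $1\le d\le m$ be integers. Let $\mathbf f(m,d)$ denote the set of $2\times 2$ minors of the $d$-catalecticant $2\times m$ generic matrix $\mathbf X(m,d)$, viewed in the polynomial ring $R=k[x_1,\ldots,x_{m+d}]$. Then $\mathbf f(m,d)$ is polarizable.
   Context: The $d$-catalecticant $2\times m$ generic matrix $\mathbf X(m,d)$ is the matrix $$\mathbf X(m,d)=\begin{pmatrix} x_1 & x_2 & \cdots & x_{m-1} & x_m\\ x_{1+d} & x_{2+d} & \cdots & x_{m-1+d} & x_{m+d}\end{pmatrix},$$ i.e. its $(1,j)$ entry is $x_j$ and its $(2,j)$ entry is $x_{j+d}$, $1\le j\le m$, where $x_1,\ldots,x_{m+d}$ are indeterminates over $k$. Polarizability: let $\mathbf f=f_1,\ldots,f_N$ be forms in a polynomial ring $R=k[x_1,\ldots,x_n]$, and let $P$ be the kernel of $k[T_1,\ldots,T_N]\to R$, $T_j\mapsto f_j$. For $f\in R$ put $df=\sum_{i=1}^n\frac{\partial f}{\partial x_i}dx_i$ in the free $R$-module $\sum_{i=1}^n R\,dx_i$. The differential syzygy module $\mathfrak{Z}$ is the kernel of the $R$-linear map $\sum_{j=1}^N R\,dT_j\to\sum_{i=1}^n R\,dx_i$, $dT_j\mapsto df_j$, where $\sum_j R\,dT_j$ is free with basis $dT_1,\ldots,dT_N$. The polar syzygy module $\mathfrak{D}\subset\mathfrak{Z}$ is the $R$-submodule generated by the vectors $\sum_{j=1}^N\frac{\partial F}{\partial T_j}(\mathbf f)\,dT_j$, $F\in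 P$. $\mathbf f$ is polarizable if $\mathfrak{D}=\mathfrak{Z}$. *)

theory Defs
  imports
    "HOL-Library.Poly_Mapping"
    "Jordan_Normal_Form.Determinant"
    "Jordan_Normal_Form.DL_Submatrix"
begin

section \<open>Multivariate polynomials\<close>

text \<open>
  A polynomial is a finitely supported family of coefficients indexed by monomials, which are
  finitely supported families of exponents. The ring operations are those of
  \<^theory>\<open>HOL-Library.Poly_Mapping\<close>. The type has one indeterminate for each element
  of \<open>'x\<close>; the polynomial ring in the indeterminates indexed by \<open>V\<close> is the
  subring \<open>poly_ring V\<close>.
\<close>

type_synonym ('x, 'a) mpoly = "('x \<Rightarrow>\<^sub>0 nat) \<Rightarrow>\<^sub>0 'a"

definition mvar :: "'x \<Rightarrow> ('x, 'a::comm_ring_1) mpoly"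
  where "mvar x = Poly_Mapping.single (Poly_Mapping.single x 1) 1"

definition mconst :: "'a \<Rightarrow> ('x, 'a::comm_ring_1) mpoly"
  where "mconst c = Poly_Mapping.single 0 c"

definition poly_ring :: "'x set \<Rightarrow> ('x, 'a::comm_ring_1) mpoly set"
  where "poly_ring V = {p. \<forall>u \<in> Poly_Mapping.keys p. Poly_Mapping.keys u \<subseteq> V}"

text \<open>\<open>msubst f F\<close> is \<open>F(f)\<close>, the image of \<open>F\<close> under the
  algebra homomorphism sending the indeterminate indexed by \<open>j\<close> to \<open>f j\<close>.\<close>

definition msubst ::
  "('i \<Rightarrow> ('x, 'a) mpoly) \<Rightarrow> ('i, 'a::comm_ring_1) mpoly \<Rightarrow> ('x, 'a) mpoly"
  where "msubst f F = (\<Sum>u \<in> Poly_Mapping.keys F.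
    mconst (Poly_Mapping.lookup F u) *
    (\<Prod>j \<in> Poly_Mapping.keys u. f j ^ Poly_Mapping.lookup u j))"

text \<open>Terms in which \<open>x\<close> does not occur get coefficient 0, so the truncated
  subtraction on exponents is harmless.\<close>

definition mpderiv :: "'x \<Rightarrow> ('x, 'a::comm_ring_1) mpoly \<Rightarrow> ('x, 'a) mpoly"
  where "mpderiv x p = (\<Sum>u \<in> Poly_Mapping.keys p.
    Poly_Mapping.single (u - Poly_Mapping.single x 1)
      (of_nat (Poly_Mapping.lookup u x) * Poly_Mapping.lookup p u))"

section \<open>Polarizability\<close>

text \<open>
  Throughout, \<open>R = poly_ring V\<close>, and \<open>f\<close> is a finite family of elements of
  \<open>R\<close> indexed by \<open>I\<close>. The element \<open>\<Sum>j\<in>I. z j dT\<^sub>j\<close> of the free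
  \<open>R\<close>-module on the \<open>dT\<^sub>j\<close> is represented by the function \<open>z\<close>,
  which vanishes outside \<open>I\<close>.
\<close>

definition free_module :: "'x set \<Rightarrow> 'i set \<Rightarrow> ('i \<Rightarrow> ('x, 'a::comm_ring_1) mpoly) set"
  where "free_module V I = {z. (\<forall>j \<in> I. z j \<in> poly_ring V) \<and> (\<forall>j. j \<notin> I \<longrightarrow> z j = 0)}"

definition submodule_generated ::
  "'x set \<Rightarrow> ('i \<Rightarrow> ('x, 'a::comm_ring_1) mpoly) set \<Rightarrow> ('i \<Rightarrow> ('x, 'a) mpoly) set"
  where "submodule_generated V S =
    {z. \<exists>A r. finite A \<and> A \<subseteq> S \<and> (\<forall>v \<in> A. r v \<in> poly_ring V) \<and>
          z = (\<lambda>j. \<Sum>v \<in> A. r v * v j)}"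

definition polynomial_relations ::
  "'i set \<Rightarrow> ('i \<Rightarrow> ('x, 'a::comm_ring_1) mpoly) \<Rightarrow> ('i, 'a) mpoly set"
  where "polynomial_relations I f = {F \<in> poly_ring I. msubst f F = 0}"

text \<open>The condition for \<open>x\<close> is the vanishing of the \<open>dx\<close>-component of
  \<open>\<Sum>j\<in>I. z j df\<^sub>j\<close>.\<close>

definition differential_syzygies ::
  "'x set \<Rightarrow> 'i set \<Rightarrow> ('i \<Rightarrow> ('x, 'a::comm_ring_1) mpoly) \<Rightarrow> ('i \<Rightarrow> ('x, 'a) mpoly) set"
  where "differential_syzygies V I f =
    {z \<in> free_module V I. \<forall>x \<in> V. (\<Sum>j \<in> I. z j * mpderiv x (f j)) = 0}"

text \<open>A relation \<open>F\<close> only involves indeterminates indexed by \<open>I\<close>, so the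
  generators below do vanish outside \<open>I\<close>.\<close>

definition polar_syzygies ::
  "'x set \<Rightarrow> 'i set \<Rightarrow> ('i \<Rightarrow> ('x, 'a::comm_ring_1) mpoly) \<Rightarrow> ('i \<Rightarrow> ('x, 'a) mpoly) set"
  where "polar_syzygies V I f =
    submodule_generated V ((\<lambda>F j. msubst f (mpderiv j F)) ` polynomial_relations I f)"

definition polarizable ::
  "'x set \<Rightarrow> 'i set \<Rightarrow> ('i \<Rightarrow> ('x, 'a::comm_ring_1) mpoly) \<Rightarrow> bool"
  where "polarizable V I f \<longleftrightarrow> polar_syzygies V I f = differential_syzygies V I f"

section \<open>Catalecticant matrices\<close>

text \<open>Rows and columns are numbered from 0, indeterminates from 1.\<close>

definition catalecticant :: "nat \<Rightarrow> nat \<Rightarrow> (nat, 'a::comm_ring_1) mpoly mat"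
  where "catalecticant m d =
    mat 2 m (\<lambda>(i, j). if i = 0 then mvar (j + 1) else mvar (j + 1 + d))"

definition minor_indices :: "nat \<Rightarrow> (nat \<times> nat) set"
  where "minor_indices m = {(j, l). j < l \<and> l < m}"

definition catalecticant_minor :: "nat \<Rightarrow> nat \<Rightarrow> nat \<times> nat \<Rightarrow> (nat, 'a::comm_ring_1) mpoly"
  where "catalecticant_minor m d = (\<lambda>(j, l). det (submatrix (catalecticant m d) UNIV {j, l}))"

end

theory Submission
  imports Defs
begin

text \<open>
  Write \<open>[j,l] = x\<^sub>j x\<^sub>l\<^sub>+\<^sub>d - x\<^sub>l x\<^sub>j\<^sub>+\<^sub>d\<close> for the minor on the columns \<open>j < l\<close>. That polar syzygies
  are differential syzygies is the chain rule. The converse is proved by degeneration to leading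
  monomials. Give the indeterminates weights that decrease so fast with the index that monomials
  of degree at most 4 are compared lexicographically; then \<open>x\<^sub>j x\<^sub>l\<^sub>+\<^sub>d\<close> is the
  leading monomial of \<open>[j,l]\<close>. These leading monomials are the edges of a graph: the vertices are
  the indeterminates, and \<open>x\<^sub>a\<close>, \<open>x\<^sub>b\<close> are joined when \<open>b - a > d\<close>.

  Give the term \<open>x\<^sup>u dT\<^sub>j\<^sub>l\<close> the multidegree of \<open>x\<^sup>u x\<^sub>j x\<^sub>l\<^sub>+\<^sub>d\<close>, and let \<open>\<mu>\<close> be a
  multidegree of maximal weight in a differential syzygy. Its coefficients are numbers on those
  edges of the graph whose two ends divide \<open>x\<^sup>\<mu>\<close>, and comparing coefficients in the syzygy
  equations shows that the numbers around each vertex add up to 0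
  (\<open>leading_weighting_zero_sum\<close>). For this graph such weightings are spanned by alternating
  4-cycles (\<open>zero_sum_weighting_mem\<close>): let \<open>p\<close> and \<open>q\<close> be the least and the greatest vertex among
  those dividing \<open>x\<^sup>\<mu>\<close>. An edge remains an edge when its lower end is moved to \<open>p\<close> or its upper end
  to \<open>q\<close>, so 4-cycles move every edge into the stars around \<open>p\<close> and \<open>q\<close>; and a weighting on two stars
  is a combination of the 4-cycles through \<open>p\<close> and \<open>q\<close>.

  Only two kinds of 4-cycles occur, and both are leading parts of polar syzygies. A cycle given by
  \<open>[b,c][a,e] - [a,c][b,e]\<close> with \<open>a < b < c < e\<close> comes from the Pluecker relation
  (\<open>plucker_relation\<close>). A cycle given by \<open>[a,b][c+d,e+d] - [a,c][b+d,e+d]\<close> comes from a second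
  quadratic relation, peculiar to catalecticant matrices
  (\<open>shifted_plucker_relation\<close>). Hence one can subtract from a differential syzygy a polar syzygy
  that cancels the multidegree \<open>\<mu>\<close> and otherwise introduces only smaller weights
  (\<open>reduce_leading_multidegree\<close>), and an induction on the weight finishes the proof.
\<close>

abbreviation "single \<equiv> Poly_Mapping.single"
abbreviation "lookup \<equiv> Poly_Mapping.lookup"
abbreviation "keys \<equiv> Poly_Mapping.keys"

section \<open>Polynomials as sums of monomials\<close>

lemma keys_diff_subset: "keys (p - q) \<subseteq> keys p \<union> keys (q :: 'x \<Rightarrow>\<^sub>0 'b::ab_group_add)"
  by (auto simp: in_keys_iff lookup_minus)

lemma poly_mapping_induct_on_keys [consumes 1, case_names zero single add]:
  fixes p :: "'x \<Rightarrow>\<^sub>0 'b::comm_monoid_add"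
  assumes keys: "keys p \<subseteq> S"
    and zero: "P 0"
    and single: "\<And>u a. u \<in> S \<Longrightarrow> P (single u a)"
    and add: "\<And>p q. P p \<Longrightarrow> P q \<Longrightarrow> P (p + q)"
  shows "P p"
proof -
  have "P (\<Sum>u \<in> K. single u (lookup p u))" if "finite K" "K \<subseteq> S" for K
    using that by (induction K rule: finite_induct) (auto intro: zero single add)
  moreover have "p = (\<Sum>u \<in> keys p. single u (lookup p u))"
    by (rule poly_mapping_eqI)
      (auto simp: lookup_sum lookup_single when_def sum.delta in_keys_iff cong: if_cong)
  ultimately show ?thesis
    using keys by (metis finite_keys)
qed

lemmas poly_mapping_induct = poly_mapping_induct_on_keys[OF subset_UNIV, case_names zero single add]

lemma lookup_mult_single:
  fixes p :: "('x, 'a::comm_ring_1) mpoly"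
  shows "lookup (p * single v a) (u + v) = lookup p u * a"
  by (induction p rule: poly_mapping_induct)
    (auto simp: mult_single lookup_single lookup_add distrib_right when_def)

lemma keys_mult_single:
  fixes p :: "('x, 'a::comm_ring_1) mpoly"
  assumes "u \<in> keys (p * single v a)"
  obtains t where "t \<in> keys p" "u = t + v"
proof -
  have "u \<in> {s + t |s t. s \<in> keys p \<and> t \<in> keys (single v a)}"
    using assms by (rule subsetD[OF keys_mult, rotated])
  then show ?thesis
    using that by (auto split: if_splits)
qed

lemma lookup_mult_scalar:
  fixes p :: "('x, 'a::comm_ring_1) mpoly"
  shows "lookup (p * single 0 a) u = lookup p u * a"
  using lookup_mult_single[of p 0 a u] by simp

section \<open>Substitution and differentiation\<close>

lemma sum_over_keys_add:
  assumes "\<And>u. g u 0 = 0" "\<And>u a b. g u (a + b) = g u a + g u b"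
  shows "(\<Sum>u \<in> keys (p + q). g u (lookup (p + q) u)) =
    (\<Sum>u \<in> keys p. g u (lookup p u)) + (\<Sum>u \<in> keys q. g u (lookup q u))"
  using setsum_keys_plus_distrib[of g p q] assms by (simp add: lookup_add)

lemma msubst_add: "msubst f (F + G) = msubst f F + msubst f G"
  unfolding msubst_def
  by (rule sum_over_keys_add) (simp_all add: mconst_def single_add distrib_right)

lemma msubst_0 [simp]: "msubst f 0 = 0"
  by (simp add: msubst_def)

lemma msubst_single:
  "msubst f (single u a) = mconst a * (\<Prod>j \<in> keys u. f j ^ lookup u j)"
  by (simp add: msubst_def mconst_def)

lemma msubst_uminus: "msubst f (- F) = - msubst f F"
  using msubst_add[of f F "- F"] by (simp add: eq_neg_iff_add_eq_0 add.commute)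

lemma msubst_diff: "msubst f (F - G) = msubst f F - msubst f G"
  using msubst_add[of f F "- G"] by (simp add: msubst_uminus)

lemma prod_power_lookup_superset:
  fixes f :: "'i \<Rightarrow> 'b::comm_ring_1"
  assumes "finite S" "keys u \<subseteq> S"
  shows "(\<Prod>j \<in> keys u. f j ^ lookup u j) = (\<Prod>j \<in> S. f j ^ lookup u j)"
  using assms by (intro prod.mono_neutral_left) (auto simp: in_keys_iff)

lemma prod_power_lookup_add:
  fixes f :: "'i \<Rightarrow> 'b::comm_ring_1"
  shows "(\<Prod>j \<in> keys (u + v). f j ^ lookup (u + v) j) =
    (\<Prod>j \<in> keys u. f j ^ lookup u j) * (\<Prod>j \<in> keys v. f j ^ lookup v j)"
proof -
  define S where "S = keys u \<union> keys v"
  have S: "w \<in> {u, v, u + v} \<Longrightarrow>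
    (\<Prod>j \<in> keys w. f j ^ lookup w j) = (\<Prod>j \<in> S. f j ^ lookup w j)" for w
    using keys_add[of u v] by (intro prod_power_lookup_superset) (auto simp: S_def)
  show ?thesis
    by (subst (1 2 3) S) (simp_all add: lookup_add power_add prod.distrib)
qed

lemma mconst_mult: "mconst (a * b) = mconst a * mconst b"
  by (simp add: mconst_def mult_single)

lemma msubst_mult: "msubst f (F * G) = msubst f F * msubst f G"
proof (induction F rule: poly_mapping_induct)
  case (single u a)
  show ?case
  proof (induction G rule: poly_mapping_induct)
    case (single v b)
    show ?case
      by (simp only: mult_single msubst_single prod_power_lookup_add mconst_mult mult_ac)
  qed (simp_all add: distrib_left msubst_add)
qed (simp_all add: distrib_right msubst_add)

lemma msubst_1 [simp]: "msubst f 1 = 1"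
  using msubst_single[of f 0 1] by (simp add: mconst_def)

lemma msubst_mvar [simp]: "msubst f (mvar i) = f i"
  by (simp add: mvar_def msubst_single mconst_def)

lemma mpderiv_add: "mpderiv x (p + q) = mpderiv x p + mpderiv x q"
  unfolding mpderiv_def
  by (rule sum_over_keys_add) (simp_all add: single_add distrib_left)

lemma mpderiv_0 [simp]: "mpderiv x 0 = 0"
  by (simp add: mpderiv_def)

lemma mpderiv_single:
  "mpderiv x (single u a) = single (u - single x 1) (of_nat (lookup u x) * a)"
  by (simp add: mpderiv_def)

lemma mpderiv_uminus: "mpderiv x (- p) = - mpderiv x p"
  using mpderiv_add[of x p "- p"] by (simp add: eq_neg_iff_add_eq_0 add.commute)

lemma mpderiv_diff: "mpderiv x (p - q) = mpderiv x p - mpderiv x q"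
  using mpderiv_add[of x p "- q"] by (simp add: mpderiv_uminus)

lemma mpderiv_mconst [simp]: "mpderiv x (mconst a) = 0"
  by (simp add: mconst_def mpderiv_single)

lemma mpderiv_mvar: "mpderiv x (mvar y) = (if x = y then 1 else 0)"
  by (auto simp: mvar_def mpderiv_single lookup_single when_def single_one)

lemma mpderiv_mult_single:
  "mpderiv x (single u a * single v b) =
    mpderiv x (single u a) * single v b + single u a * mpderiv x (single v b)"
proof -
  have shift: "single (s - single x 1 + t) (of_nat (lookup s x) * c) =
      single (s + t - single x 1) (of_nat (lookup s x) * c)"
    for s t :: "'a \<Rightarrow>\<^sub>0 nat" and c :: 'b
  proof (cases "lookup s x = 0")
    case False
    then have "s - single x 1 + t = s + t - single x 1"
      by (intro poly_mapping_eqI) (auto simp: lookup_add lookup_minus lookup_single when_def)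
    then show ?thesis by simp
  qed simp
  show ?thesis
    using shift[of u v "a * b"] shift[of v u "a * b"]
    by (simp add: mult_single mpderiv_single lookup_add distrib_left distrib_right
        ac_simps flip: single_add)
qed

lemma mpderiv_mult: "mpderiv x (p * q) = mpderiv x p * q + p * mpderiv x q"
proof (induction p rule: poly_mapping_induct)
  case (single u a)
  show ?case
  proof (induction q rule: poly_mapping_induct)
    case (single v b)
    show ?case by (rule mpderiv_mult_single)
  qed (simp_all add: distrib_left mpderiv_add algebra_simps)
qed (simp_all add: distrib_right mpderiv_add algebra_simps)

text \<open>Euler's operator is diagonal on monomials; unlike the bare derivative it does not shift
  exponents, so no case distinction on exponent 0 is needed when coefficients are compared.\<close>

lemma mvar_mult_mpderiv_single:
  "mvar x * mpderiv x (single u a) = single u (of_nat (lookup u x) * a)"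
proof (cases "lookup u x = 0")
  case False
  then have "single x 1 + (u - single x 1) = u"
    by (intro poly_mapping_eqI) (auto simp: lookup_add lookup_minus lookup_single when_def)
  then show ?thesis
    by (simp add: mvar_def mpderiv_single mult_single)
qed (simp add: mpderiv_single)

section \<open>The polynomial ring in a set of indeterminates\<close>

lemma poly_ring_0 [simp]: "0 \<in> poly_ring V"
  by (simp add: poly_ring_def)

lemma poly_ring_single: "keys u \<subseteq> V \<Longrightarrow> single u a \<in> poly_ring V"
  by (simp add: poly_ring_def)

lemma poly_ring_mconst [simp]: "mconst a \<in> poly_ring V"
  by (simp add: mconst_def poly_ring_single)

lemma poly_ring_1 [simp]: "1 \<in> poly_ring V"
  using poly_ring_mconst[of 1 V] by (simp add: mconst_def)

lemma poly_ring_mvar: "x \<in> V \<Longrightarrow> mvar x \<in> poly_ring V"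
  by (simp add: mvar_def poly_ring_single)

lemma poly_ring_add: "p \<in> poly_ring V \<Longrightarrow> q \<in> poly_ring V \<Longrightarrow> p + q \<in> poly_ring V"
  using keys_add[of p q] by (auto simp: poly_ring_def)

lemma poly_ring_uminus: "p \<in> poly_ring V \<Longrightarrow> - p \<in> poly_ring V"
  by (simp add: poly_ring_def in_keys_iff)

lemma poly_ring_diff: "p \<in> poly_ring V \<Longrightarrow> q \<in> poly_ring V \<Longrightarrow> p - q \<in> poly_ring V"
  using poly_ring_add[of p V "- q"] by (simp add: poly_ring_uminus)

lemma poly_ring_mult:
  assumes "p \<in> poly_ring V" "q \<in> poly_ring V"
  shows "p * q \<in> poly_ring V"
  unfolding poly_ring_def
proof (intro CollectI ballI)
  fix u assume "u \<in> keys (p * q)"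
  then obtain s t where "s \<in> keys p" "t \<in> keys q" "u = s + t"
    using keys_mult by blast
  then show "keys u \<subseteq> V"
    using assms keys_add[of s t] by (fastforce simp: poly_ring_def)
qed

lemma poly_ring_sum: "(\<And>i. i \<in> A \<Longrightarrow> g i \<in> poly_ring V) \<Longrightarrow> sum g A \<in> poly_ring V"
  by (induction A rule: infinite_finite_induct) (auto intro: poly_ring_add)

lemma poly_ring_induct [consumes 1, case_names const var add mult]:
  fixes p :: "('x, 'a::comm_ring_1) mpoly"
  assumes p: "p \<in> poly_ring V"
    and const: "\<And>a. P (mconst a)"
    and var: "\<And>x. x \<in> V \<Longrightarrow> P (mvar x)"
    and add: "\<And>p q. p \<in> poly_ring V \<Longrightarrow> q \<in> poly_ring V \<Longrightarrow> P p \<Longrightarrow> P q \<Longrightarrow> P (p + q)"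
    and mult: "\<And>p q. p \<in> poly_ring V \<Longrightarrow> q \<in> poly_ring V \<Longrightarrow> P p \<Longrightarrow> P q \<Longrightarrow> P (p * q)"
  shows "P p"
proof -
  define Q where "Q p \<longleftrightarrow> p \<in> poly_ring V \<and> P p" for p
  have Q1: "Q 1"
    using const[of 1] by (simp add: Q_def mconst_def)
  have Qmult: "Q (p * q)" if "Q p" "Q q" for p q
    using that mult by (auto simp: Q_def poly_ring_mult)
  have Qmonom: "Q (single u 1)" if "keys u \<subseteq> V" for u
    using that
  proof (induction u rule: poly_mapping_induct_on_keys)
    case (single x n)
    show ?case
    proof (induction n)
      case (Suc n)
      have "Q (mvar x * single (single x n) 1)"
        using Suc single var by (intro Qmult) (auto simp: Q_def poly_ring_mvar)
      then show ?case by (simp add: mvar_def mult_single flip: single_add)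
    qed (use Q1 in simp)
  next
    case (add u v)
    then show ?case using Qmult[of "single u 1" "single v 1"] by (simp add: mult_single)
  qed (use Q1 in simp)
  have "Q p"
  proof (rule poly_mapping_induct_on_keys[where S = "{u. keys u \<subseteq> V}"])
    show "keys p \<subseteq> {u. keys u \<subseteq> V}"
      using p by (auto simp: poly_ring_def)
    show "Q 0"
      using const[of 0] by (simp add: Q_def mconst_def)
    show "Q (single u a)" if "u \<in> {u. keys u \<subseteq> V}" for u a
      using Qmult[of "mconst a" "single u 1"] that Qmonom[of u] const
      by (simp add: Q_def mconst_def mult_single poly_ring_single)
    show "Q (p + q)" if "Q p" "Q q" for p q
      using that add by (auto simp: Q_def poly_ring_add)
  qed
  then show ?thesis by (simp add: Q_def)
qed

lemma poly_ring_mpderiv: "p \<in> poly_ring V \<Longrightarrow> mpderiv x p \<in> poly_ring V"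
  by (induction rule: poly_ring_induct)
    (auto simp: mpderiv_mvar mpderiv_add mpderiv_mult
      intro!: poly_ring_add poly_ring_mult)

lemma mpderiv_eq_0: "p \<in> poly_ring V \<Longrightarrow> x \<notin> V \<Longrightarrow> mpderiv x p = 0"
  by (induction rule: poly_ring_induct) (auto simp: mpderiv_mvar mpderiv_add mpderiv_mult)

lemma poly_ring_msubst:
  assumes "F \<in> poly_ring I" "\<And>j. j \<in> I \<Longrightarrow> f j \<in> poly_ring V"
  shows "msubst f F \<in> poly_ring V"
  using assms(1)
  by (induction rule: poly_ring_induct)
    (auto simp: msubst_add msubst_mult assms(2) mconst_def msubst_single[of f 0]
      intro: poly_ring_add poly_ring_mult poly_ring_single)

lemma mpderiv_msubst:
  assumes F: "F \<in> poly_ring I" and I: "finite I"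
  shows "mpderiv x (msubst f F) = (\<Sum>j \<in> I. msubst f (mpderiv j F) * mpderiv x (f j))"
  using F
proof (induction rule: poly_ring_induct)
  case (const a)
  show ?case
    by (simp add: mconst_def msubst_single mpderiv_single)
next
  case (var i)
  have "(\<Sum>j \<in> I. msubst f (mpderiv j (mvar i)) * mpderiv x (f j)) =
      (\<Sum>j \<in> I. if j = i then mpderiv x (f j) else 0)"
    by (intro sum.cong) (auto simp: mpderiv_mvar)
  then show ?case
    using var I by simp
next
  case (add p q)
  then show ?case
    by (simp add: msubst_add mpderiv_add distrib_right sum.distrib)
next
  case (mult p q)
  then show ?case
    by (simp add: msubst_add msubst_mult mpderiv_add mpderiv_mult distrib_right sum.distrib
        sum_distrib_left sum_distrib_right algebra_simps)
qed

section \<open>Polar and differential syzygies\<close>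

lemma submodule_generated_0: "(\<lambda>j. 0) \<in> submodule_generated V S"
  unfolding submodule_generated_def by (intro CollectI exI[of _ "{}"]) auto

lemma submodule_generated_smult_generator:
  assumes "v \<in> S" "r \<in> poly_ring V"
  shows "(\<lambda>j. r * v j) \<in> submodule_generated V S"
  unfolding submodule_generated_def
  using assms by (intro CollectI exI[of _ "{v}"] exI[of _ "\<lambda>_. r"]) auto

lemma submodule_generated_add:
  assumes "z \<in> submodule_generated V S" "z' \<in> submodule_generated V S"
  shows "(\<lambda>j. z j + z' j) \<in> submodule_generated V S"
proof -
  obtain A r where A: "finite A" "A \<subseteq> S" "\<forall>v \<in> A. r v \<in> poly_ring V"
    and z: "z = (\<lambda>j. \<Sum>v \<in> A. r v * v j)"
    using assms(1) by (auto simp: submodule_generated_def)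
  obtain A' r' where A': "finite A'" "A' \<subseteq> S" "\<forall>v \<in> A'. r' v \<in> poly_ring V"
    and z': "z' = (\<lambda>j. \<Sum>v \<in> A'. r' v * v j)"
    using assms(2) by (auto simp: submodule_generated_def)
  define R where "R v = (if v \<in> A then r v else 0) + (if v \<in> A' then r' v else 0)" for v
  have "(\<Sum>v \<in> A. r v * v j) = (\<Sum>v \<in> A \<union> A'. (if v \<in> A then r v else 0) * v j)" for j
    by (rule sum.mono_neutral_cong_left) (use A A' in auto)
  moreover have "(\<Sum>v \<in> A'. r' v * v j) = (\<Sum>v \<in> A \<union> A'. (if v \<in> A' then r' v else 0) * v j)" for j
    by (rule sum.mono_neutral_cong_left) (use A A' in auto)
  ultimately have "z j + z' j = (\<Sum>v \<in> A \<union> A'. R v * v j)" for j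
    by (simp add: z z' R_def distrib_right sum.distrib)
  moreover have "\<forall>v \<in> A \<union> A'. R v \<in> poly_ring V"
    using A A' by (auto simp: R_def intro: poly_ring_add)
  ultimately show ?thesis
    unfolding submodule_generated_def
    using A A' by (intro CollectI exI[of _ "A \<union> A'"] exI[of _ R]) auto
qed

lemma submodule_generated_smult:
  assumes "z \<in> submodule_generated V S" "s \<in> poly_ring V"
  shows "(\<lambda>j. s * z j) \<in> submodule_generated V S"
proof -
  obtain A r where "finite A" "A \<subseteq> S" "\<forall>v \<in> A. r v \<in> poly_ring V"
    and "z = (\<lambda>j. \<Sum>v \<in> A. r v * v j)"
    using assms(1) by (auto simp: submodule_generated_def)
  then show ?thesis
    unfolding submodule_generated_def
    using assms(2)
    by (intro CollectI exI[of _ A] exI[of _ "\<lambda>v. s * r v"])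
      (auto intro: poly_ring_mult simp: sum_distrib_left mult.assoc)
qed

text \<open>Differentiating \<open>F(f) = 0\<close> by the chain rule shows that every polar syzygy is a
  differential syzygy.\<close>

lemma polar_syzygies_subset_differential_syzygies:
  assumes I: "finite I" and f: "\<And>j. j \<in> I \<Longrightarrow> f j \<in> poly_ring V"
  shows "polar_syzygies V I f \<subseteq> differential_syzygies V I f"
proof
  fix z assume "z \<in> polar_syzygies V I f"
  then obtain A r where A: "A \<subseteq> (\<lambda>F j. msubst f (mpderiv j F)) ` polynomial_relations I f"
    and r: "\<forall>v \<in> A. r v \<in> poly_ring V" and z: "z = (\<lambda>j. \<Sum>v \<in> A. r v * v j)"
    unfolding polar_syzygies_def submodule_generated_def by auto
  have v: "(\<forall>j \<in> I. v j \<in> poly_ring V) \<and> (\<forall>j. j \<notin> I \<longrightarrow> v j = 0)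
      \<and> (\<Sum>j \<in> I. v j * mpderiv x (f j)) = 0" if "v \<in> A" for v x
  proof -
    from that A obtain F where F: "F \<in> poly_ring I" "msubst f F = 0"
      and v: "v = (\<lambda>j. msubst f (mpderiv j F))"
      by (auto simp: polynomial_relations_def)
    have "(\<Sum>j \<in> I. v j * mpderiv x (f j)) = 0"
      using mpderiv_msubst[OF F(1) I, of x f] F(2) by (simp add: v)
    then show ?thesis
      using F f by (auto simp: v mpderiv_eq_0 intro!: poly_ring_msubst poly_ring_mpderiv)
  qed
  have "(\<Sum>j \<in> I. z j * mpderiv x (f j)) = 0" for x
  proof -
    have "(\<Sum>j \<in> I. z j * mpderiv x (f j)) = (\<Sum>j \<in> I. \<Sum>v \<in> A. r v * (v j * mpderiv x (f j)))"
      by (simp add: z sum_distrib_right mult.assoc)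
    also have "\<dots> = (\<Sum>v \<in> A. r v * (\<Sum>j \<in> I. v j * mpderiv x (f j)))"
      by (subst sum.swap) (simp add: sum_distrib_left)
    also have "\<dots> = 0"
      using v by (intro sum.neutral) auto
    finally show ?thesis .
  qed
  moreover have "z \<in> free_module V I"
    unfolding free_module_def z using v r
    by (fastforce intro!: poly_ring_sum poly_ring_mult sum.neutral)
  ultimately show "z \<in> differential_syzygies V I f"
    by (simp add: differential_syzygies_def)
qed

lemma differential_syzygies_diff:
  assumes "z \<in> differential_syzygies V I f" "z' \<in> differential_syzygies V I f"
  shows "(\<lambda>j. z j - z' j) \<in> differential_syzygies V I f"
  using assms
  by (auto simp: differential_syzygies_def free_module_def poly_ring_diff left_diff_distrib
      sum_subtractf)

section \<open>Edge weightings with vanishing vertex sums\<close>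

text \<open>The edge with indices \<open>(j, l)\<close> joins the vertices \<open>j\<close> and \<open>l + d\<close>. Indexing edges by pairs of
  columns instead of pairs of vertices makes a weighting directly comparable with a vector of
  coefficients of the \<open>dT\<^sub>j\<^sub>l\<close>. Vertex \<open>i\<close> stands for the indeterminate \<open>x\<^sub>i\<^sub>+\<^sub>1\<close>.\<close>

definition edges_on :: "nat \<Rightarrow> nat set \<Rightarrow> (nat \<times> nat) set" where
  "edges_on d A = {(j, l). j < l \<and> j \<in> A \<and> l + d \<in> A}"

definition edge :: "nat \<times> nat \<Rightarrow> nat \<times> nat \<Rightarrow> 'k::comm_ring_1" where
  "edge e = (\<lambda>e'. if e' = e then 1 else 0)"

definition vertex_sum :: "nat \<Rightarrow> nat set \<Rightarrow> (nat \<times> nat \<Rightarrow> 'k::comm_ring_1) \<Rightarrow> nat \<Rightarrow> 'k" where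
  "vertex_sum d A c x =
    (\<Sum>(j, l) \<in> edges_on d A. ((if j = x then 1 else 0) + (if l + d = x then 1 else 0)) * c (j, l))"

text \<open>The vertices of this 4-cycle are \<open>a < b < c + d < e + d\<close>; its name refers to the
  positive edges, of which the first lies inside the second.\<close>

definition nested_cycle :: "nat \<Rightarrow> nat \<Rightarrow> nat \<Rightarrow> nat \<Rightarrow> nat \<times> nat \<Rightarrow> 'k::comm_ring_1" where
  "nested_cycle a b c e = (\<lambda>s. edge (b, c) s + edge (a, e) s - edge (b, e) s - edge (a, c) s)"

text \<open>Here the vertices are \<open>a < b + d < c + d < e + 2 d\<close>, and the positive edges are disjoint
  intervals.\<close>

definition disjoint_cycle :: "nat \<Rightarrow> nat \<Rightarrow> nat \<Rightarrow> nat \<Rightarrow> nat \<Rightarrow> nat \<times> nat \<Rightarrow> 'k::comm_ring_1" where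
  "disjoint_cycle d a b c e =
    (\<lambda>s. edge (a, b) s + edge (c + d, e + d) s - edge (a, c) s - edge (b + d, e + d) s)"

lemma finite_edges_on: "finite A \<Longrightarrow> finite (edges_on d A)"
  by (rule finite_subset[of _ "A \<times> ((\<lambda>x. x - d) ` A)"]) (force simp: edges_on_def image_iff)+

lemma vertex_sum_lincomb:
  "vertex_sum d A (\<lambda>e. c e + t * c' e) x = vertex_sum d A c x + t * vertex_sum d A c' x"
  unfolding vertex_sum_def
  by (simp add: sum_distrib_left case_prod_unfold algebra_simps flip: sum.distrib)

lemma vertex_sum_edge:
  assumes "finite A" "(j, l) \<in> edges_on d A"
  shows "vertex_sum d A (edge (j, l)) x =
    (if j = x then 1 else 0) + (if l + d = x then 1 else 0)"
proof -
  have "vertex_sum d A (edge (j, l)) x =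
    (\<Sum>e \<in> edges_on d A. if e = (j, l) then (if j = x then 1 else 0) + (if l + d = x then 1 else 0) else 0)"
    unfolding vertex_sum_def
  proof (intro sum.cong refl)
    fix e
    show "(case e of (i, k) \<Rightarrow> ((if i = x then 1 else 0) + (if k + d = x then 1 else 0)) *
        edge (j, l) (i, k)) =
      (if e = (j, l) then (if j = x then 1 else 0) + (if l + d = x then 1 else 0) else 0)"
      by (cases e; cases "e = (j, l)") (auto simp: edge_def)
  qed
  then show ?thesis
    using assms by (simp add: finite_edges_on)
qed

lemma vertex_sum_add: "vertex_sum d A (\<lambda>e. c e + c' e) x = vertex_sum d A c x + vertex_sum d A c' x"
  using vertex_sum_lincomb[of d A c 1 c' x] by simp

lemma vertex_sum_minus: "vertex_sum d A (\<lambda>e. c e - c' e) x = vertex_sum d A c x - vertex_sum d A c' x"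
  using vertex_sum_lincomb[of d A c "-1" c' x] by simp

lemma vertex_sum_nested_cycle:
  assumes "finite A" "{(b, c), (a, e), (b, e), (a, c)} \<subseteq> edges_on d A"
  shows "vertex_sum d A (nested_cycle a b c e) x = 0"
  using assms unfolding nested_cycle_def
  by (simp add: vertex_sum_add vertex_sum_minus vertex_sum_edge)

text \<open>Used to evaluate a vertex sum at which only one or two edges have nonzero weight.\<close>

lemma vertex_sum_restrict:
  assumes "finite A" and supp: "\<And>e. c e \<noteq> 0 \<Longrightarrow> e \<in> edges_on d A"
    and "finite T" and T: "\<And>j l. c (j, l) \<noteq> 0 \<Longrightarrow> j = x \<or> l + d = x \<Longrightarrow> (j, l) \<in> T"
  shows "vertex_sum d A c x =
    (\<Sum>(j, l) \<in> T. ((if j = x then 1 else 0) + (if l + d = x then 1 else 0)) * c (j, l))"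
proof -
  let ?g = "\<lambda>(j, l). ((if j = x then 1 else 0) + (if l + d = x then 1 else 0)) * c (j, l)"
  have "?g e = 0" if "e \<in> edges_on d A - edges_on d A \<inter> T" for e
  proof -
    obtain a b where e: "e = (a, b)" by force
    show ?thesis
      using T[of a b] that by (cases "c (a, b) = 0") (auto simp: e)
  qed
  then have "sum ?g (edges_on d A) = sum ?g (edges_on d A \<inter> T)"
    using assms(1) by (intro sum.mono_neutral_right) (auto simp: finite_edges_on)
  also have "\<dots> = sum ?g T"
  proof (rule sum.mono_neutral_left)
    show "\<forall>e \<in> T - edges_on d A \<inter> T. ?g e = 0"
    proof
      fix e assume "e \<in> T - edges_on d A \<inter> T"
      then have "c e = 0" using supp by blast
      then show "?g e = 0" by (cases e) simp
    qed
  qed (use assms(3) in auto)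
  finally show ?thesis
    by (simp add: vertex_sum_def)
qed

text \<open>Any space of weightings that contains the two kinds of 4-cycles on the vertex set \<open>A\<close>. It will be
  instantiated with the leading parts of polar syzygies in a fixed multidegree.\<close>

locale cycle_space =
  fixes d :: nat and A :: "nat set" and G :: "(nat \<times> nat \<Rightarrow> 'k::field_char_0) set"
  assumes A: "finite A"
    and zero: "(\<lambda>e. 0) \<in> G"
    and lincomb: "\<And>c t c'. c \<in> G \<Longrightarrow> c' \<in> G \<Longrightarrow> (\<lambda>e. c e + t * c' e) \<in> G"
    and nested: "\<And>a b c e. a < b \<Longrightarrow> b < c \<Longrightarrow> c < e \<Longrightarrow>
      {a, b, c + d, e + d} \<subseteq> A \<Longrightarrow> nested_cycle a b c e \<in> G"
    and disjoint: "\<And>a b c e. a < b \<Longrightarrow> b < c \<Longrightarrow> c < e \<Longrightarrow>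
      {a, b + d, c + d, e + 2 * d} \<subseteq> A \<Longrightarrow> disjoint_cycle d a b c e \<in> G"
begin

text \<open>Suppose all edges carrying weight meet \<open>p\<close> or the greatest vertex \<open>q = Q + d\<close>. Every other vertex
  \<open>v\<close> then lies on at most the two edges to \<open>p\<close> and \<open>q\<close>, which therefore carry opposite weights. If
  \<open>v\<close> and \<open>w\<close> are two vertices of this kind, adding a multiple of the 4-cycle \<open>p, v, q, w\<close> clears \<open>v\<close>, and
  the induction is on the number of such vertices. The sums at \<open>p\<close> and \<open>q\<close> exclude that just one is left.\<close>

lemma star_weighting_mem:
  fixes p Q :: nat
  assumes supp: "\<And>e. c e \<noteq> 0 \<Longrightarrow> e \<in> edges_on d A"
    and vs: "\<And>x. vertex_sum d A c x = 0"
    and bounds: "\<And>x. x \<in> A \<Longrightarrow> p \<le> x \<and> x \<le> Q + d"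
    and star: "\<And>j l. c (j, l) \<noteq> 0 \<Longrightarrow> j = p \<or> l = Q"
  shows "c \<in> G"
  using supp vs star
proof (induction "card {x. p < x \<and> x < Q + d \<and> c (x, Q) \<noteq> 0}" arbitrary: c rule: less_induct)
  case less
  note supp = less.prems(1) and vs = less.prems(2) and star = less.prems(3)
  let ?S = "\<lambda>c :: nat \<times> nat \<Rightarrow> 'k. {x. p < x \<and> x < Q + d \<and> c (x, Q) \<noteq> 0}"
  have in_A: "j < l" "j \<in> A" "l + d \<in> A" "p \<le> j" "l \<le> Q" if "c (j, l) \<noteq> 0" for j l
    using supp[OF that] bounds[of j] bounds[of "l + d"] by (auto simp: edges_on_def)
  have interior: "c (x, Q) + (if d \<le> x then c (p, x - d) else 0) = 0" if x: "p < x" "x < Q + d" for x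
  proof -
    let ?T = "insert (x, Q) (if d \<le> x then {(p, x - d)} else {})"
    have "vertex_sum d A c x =
        (\<Sum>(j, l) \<in> ?T. ((if j = x then 1 else 0) + (if l + d = x then 1 else 0)) * c (j, l))"
      using star x by (intro vertex_sum_restrict[OF A supp]) fastforce+
    then show ?thesis
      using x vs by (auto split: if_splits)
  qed
  show ?case
  proof (cases "?S c = {}")
    case True
    have p: "l = Q" if "c (p, l) \<noteq> 0" for l
    proof (rule ccontr)
      assume "l \<noteq> Q"
      then have "p < l + d" "l + d < Q + d"
        using in_A[OF that] by auto
      then show False
        using interior[of "l + d"] True that by auto
    qed
    have "vertex_sum d A c p =
        (\<Sum>(j, l) \<in> {(p, Q)}.
          ((if j = p then 1 else 0) + (if l + d = p then 1 else 0)) * c (j, l))"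
      using p in_A by (intro vertex_sum_restrict[OF A supp]) fastforce+
    then have pQ: "c (p, Q) = 0"
      using vs in_A[of p Q] by (auto split: if_splits)
    have "c (j, l) = 0" for j l
    proof (rule ccontr)
      assume jl: "c (j, l) \<noteq> 0"
      then have "l = Q" "j \<noteq> p"
        using star p pQ by auto
      then show False
        using in_A[OF jl] True jl by force
    qed
    then have "c = (\<lambda>e. 0)" by auto
    then show ?thesis using zero by simp
  next
    case False
    then obtain v where v: "p < v" "v < Q + d" "c (v, Q) \<noteq> 0" by auto
    have partner: "d \<le> x" "c (p, x - d) \<noteq> 0" if "p < x" "x < Q + d" "c (x, Q) \<noteq> 0" for x
      using interior[OF that(1,2)] that(3) by (auto split: if_splits)
    have pv: "c (p, v - d) = - c (v, Q)"
      using interior[OF v(1,2)] partner[OF v] by (simp add: eq_neg_iff_add_eq_0 add.commute)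
    \<comment> \<open>If no second common neighbour existed, the sums at both centres would give
      \<open>2 c (v, Q) = 0\<close>, whereas 2 is invertible.\<close>
    have "\<exists>w. w \<noteq> v \<and> p < w \<and> w < Q + d \<and> c (w, Q) \<noteq> 0"
    proof (rule ccontr)
      assume unique: "\<not> ?thesis"
      have l: "l = v - d \<or> l = Q" if "c (p, l) \<noteq> 0" for l
      proof (rule ccontr)
        assume l: "\<not> ?thesis"
        then have "p < l + d" "l + d < Q + d"
          using in_A[OF that] by auto
        then have "c (l + d, Q) \<noteq> 0"
          using interior[of "l + d"] that by auto
        then have "l + d = v"
          using unique \<open>p < l + d\<close> \<open>l + d < Q + d\<close> by blast
        with l show False by force
      qed
      have j: "j = v \<or> j = p" if "c (j, Q) \<noteq> 0" for j
      proof (rule disjCI)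
        assume "j \<noteq> p"
        then have "p < j" "j < Q + d" using in_A[OF that] by auto
        then show "j = v" using unique that by blast
      qed
      have ne: "v - d \<noteq> Q" "p \<noteq> v - d + d" "p < Q + d"
        using v partner[OF v] by auto
      have "vertex_sum d A c p =
          (\<Sum>(j, l) \<in> {(p, v - d), (p, Q)}.
            ((if j = p then 1 else 0) + (if l + d = p then 1 else 0)) * c (j, l))"
        using l in_A by (intro vertex_sum_restrict[OF A supp]) fastforce+
      then have "c (p, v - d) + c (p, Q) = 0"
        using vs ne by auto
      moreover have "vertex_sum d A c (Q + d) =
          (\<Sum>(j, l) \<in> {(v, Q), (p, Q)}.
            ((if j = Q + d then 1 else 0) + (if l + d = Q + d then 1 else 0)) * c (j, l))"
        using j in_A by (intro vertex_sum_restrict[OF A supp]) fastforce+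
      then have "c (v, Q) + c (p, Q) = 0"
        using vs ne v by auto
      ultimately have "2 * c (v, Q) = 0"
        using pv by (simp add: eq_neg_iff_add_eq_0 algebra_simps)
      then show False using v by simp
    qed
    then obtain w where w: "w \<noteq> v" "p < w" "w < Q + d" "c (w, Q) \<noteq> 0" by auto
    \<comment> \<open>Up to the sign, which depends on the order of \<open>v\<close> and \<open>w\<close>, this is a disjoint 4-cycle.\<close>
    let ?\<gamma> = "\<lambda>e. edge (p, v - d) e + edge (w, Q) e - edge (p, w - d) e - edge (v, Q) e :: 'k"
    have sub: "{(p, v - d), (w, Q), (p, w - d), (v, Q)} \<subseteq> edges_on d A"
      using supp v w partner[OF v] partner[OF w(2-4)] by auto
    have \<gamma>: "?\<gamma> \<in> G"
    proof -
      have *: "disjoint_cycle d p (x - d) (y - d) (Q - d) \<in> G"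
        if "x < y" "d \<le> x" "{(p, x - d), (y, Q), (p, y - d), (x, Q)} \<subseteq> edges_on d A" for x y
        using that by (intro disjoint) (auto simp: edges_on_def add.commute)
      have **: "d \<le> Q" using in_A[OF w(4)] partner(1)[OF w(2-4)] by simp
      show ?thesis
      proof (cases "v < w")
        case True
        then show ?thesis
          using *[OF True partner(1)[OF v] sub] ** partner(1)[OF v] partner(1)[OF w(2-4)]
          by (simp add: disjoint_cycle_def)
      next
        case False
        then have "w < v" using w by simp
        then have "disjoint_cycle d p (w - d) (v - d) (Q - d) \<in> G"
          using sub by (intro *[OF _ partner(1)[OF w(2-4)]]) auto
        from lincomb[OF zero this, of "-1"] show ?thesis
          using ** partner(1)[OF v] partner(1)[OF w(2-4)]
          by (simp add: disjoint_cycle_def algebra_simps)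
      qed
    qed
    let ?c = "\<lambda>e. c e + c (v, Q) * ?\<gamma> e"
    have "v \<in> ?S c - ?S ?c"
      using v w by (simp add: edge_def)
    moreover have "x \<in> ?S c" if x: "x \<in> ?S ?c" for x
    proof (cases "x = v \<or> x = w")
      case True
      then show ?thesis using v w by auto
    next
      case False
      then have "?c (x, Q) = c (x, Q)" using x by (auto simp: edge_def)
      then show ?thesis using x by auto
    qed
    ultimately have "?S ?c \<subset> ?S c" by blast
    then have "card (?S ?c) < card (?S c)"
      by (intro psubset_card_mono) auto
    then have "?c \<in> G"
    proof (rule less.hyps)
      show "e \<in> edges_on d A" if "?c e \<noteq> 0" for e
        using that supp sub by (cases "c e = 0") (auto simp: edge_def split: if_splits)
      show "vertex_sum d A ?c x = 0" for x
        using sub by (simp add: vertex_sum_lincomb vertex_sum_add vertex_sum_minus vs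
            vertex_sum_edge[OF A] partner(1)[OF v] partner(1)[OF w(2-4)])
      show "j = p \<or> l = Q" if "?c (j, l) \<noteq> 0" for j l
        using that star[of j l] by (auto simp: edge_def split: if_splits)
    qed
    from lincomb[OF this \<gamma>, of "- c (v, Q)"] show ?thesis
      by simp
  qed
qed

text \<open>An edge \<open>(j, l)\<close> avoiding both the least vertex \<open>p\<close> and the greatest vertex \<open>Q + d\<close> is cleared by
  the nested 4-cycle that it forms with \<open>p\<close> and \<open>Q + d\<close>: its three other edges are at least as long, so
  they belong to the graph, and they meet \<open>p\<close> or \<open>Q + d\<close>. What remains is supported on two stars.\<close>

lemma zero_sum_weighting_mem:
  assumes supp: "\<And>e. c e \<noteq> 0 \<Longrightarrow> e \<in> edges_on d A"
    and vs: "\<And>x. vertex_sum d A c x = 0"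
  shows "c \<in> G"
proof (cases "edges_on d A = {}")
  case True
  then have "c = (\<lambda>e. 0)" using supp by blast
  then show ?thesis using zero by simp
next
  case False
  then obtain j0 l0 where jl0: "(j0, l0) \<in> edges_on d A" by auto
  define p where "p = Min A"
  define Q where "Q = Max A - d"
  have "l0 + d \<in> A" using jl0 by (auto simp: edges_on_def)
  then have "l0 + d \<le> Max A" "A \<noteq> {}" using A by auto
  then have Q: "Q + d = Max A" by (simp add: Q_def)
  have pQ: "p \<in> A" "Q + d \<in> A"
    using A \<open>A \<noteq> {}\<close> by (auto simp: p_def Q)
  have bounds: "p \<le> x \<and> x \<le> Q + d" if "x \<in> A" for x
    using that A by (simp add: p_def Q)
  show ?thesis
    using supp vs
  proof (induction "card {(j, l). c (j, l) \<noteq> 0 \<and> j \<noteq> p \<and> l \<noteq> Q}" arbitrary: c rule: less_induct)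
    case less
    note supp = less.prems(1) and vs = less.prems(2)
    let ?S = "\<lambda>c :: nat \<times> nat \<Rightarrow> 'k. {(j, l). c (j, l) \<noteq> 0 \<and> j \<noteq> p \<and> l \<noteq> Q}"
    have fin: "finite (?S c)"
      by (rule finite_subset[OF _ finite_edges_on[OF A, of d]]) (use supp in auto)
    show ?case
    proof (cases "?S c = {}")
      case True
      then show ?thesis
        by (intro star_weighting_mem[OF supp vs bounds]) auto
    next
      case False
      then obtain j l where jl: "c (j, l) \<noteq> 0" "j \<noteq> p" "l \<noteq> Q" by auto
      have e: "j < l" "j \<in> A" "l + d \<in> A" "p < j" "l < Q"
        using supp[OF jl(1)] bounds[of j] bounds[of "l + d"] jl by (auto simp: edges_on_def)
      let ?\<gamma> = "nested_cycle p j l Q :: nat \<times> nat \<Rightarrow> 'k"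
      have \<gamma>: "?\<gamma> \<in> G"
        using e pQ by (intro nested) auto
      have sub: "{(j, l), (p, Q), (j, Q), (p, l)} \<subseteq> edges_on d A"
        using e pQ by (auto simp: edges_on_def)
      let ?c = "\<lambda>e. c e + (- c (j, l)) * ?\<gamma> e"
      have "(j, l) \<in> ?S c - ?S ?c"
        using jl by (simp add: nested_cycle_def edge_def)
      moreover have "?c (a, b) = c (a, b)" if "a \<noteq> p" "b \<noteq> Q" "(a, b) \<noteq> (j, l)" for a b
        using that by (auto simp: nested_cycle_def edge_def)
      then have "?S ?c \<subseteq> ?S c"
        using jl by fastforce
      ultimately have "?S ?c \<subset> ?S c" by blast
      then have "card (?S ?c) < card (?S c)"
        using fin by (intro psubset_card_mono)
      then have "?c \<in> G"
      proof (rule less.hyps)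
        show "e \<in> edges_on d A" if "?c e \<noteq> 0" for e
          using that supp sub
        by (cases "c e = 0") (auto simp: nested_cycle_def edge_def split: if_splits)
        show "vertex_sum d A ?c x = 0" for x
          using sub by (simp only: vertex_sum_lincomb vs vertex_sum_nested_cycle[OF A]) simp
      qed
      from lincomb[OF this \<gamma>, of "c (j, l)"] show ?thesis
        by simp
    qed
  qed
qed

end

section \<open>Catalecticant minors and the relations among them\<close>

lemma det_two_by_two:
  assumes A: "A \<in> carrier_mat 2 2"
  shows "det A = A $$ (0, 0) * A $$ (1, 1) - A $$ (0, 1) * A $$ (1, 0)"
proof -
  have cof: "det (mat_delete A i 0) = A $$ (1 - i, 1)" if "i < 2" for i
    using A that
    by (subst det_single) (auto simp: mat_delete_def less_2_cases_iff)
  have "det A = (\<Sum>i<2. A $$ (i, 0) * cofactor A i 0)"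
    by (rule laplace_expansion_column[OF A]) simp
  then show ?thesis
    using cof[of 0] cof[of 1]
    by (simp add: cofactor_def numeral_2_eq_2 lessThan_Suc algebra_simps)
qed

text \<open>For \<open>j < l\<close> this is the exponent of the leading monomial of the minor on the columns \<open>j\<close> and \<open>l\<close>; with
  the arguments exchanged it is the exponent of the other monomial. Columns are numbered from 0
  and indeterminates from 1.\<close>

definition leading :: "nat \<Rightarrow> nat \<Rightarrow> nat \<Rightarrow> nat \<Rightarrow>\<^sub>0 nat" where
  "leading d j l = single (j + 1) 1 + single (l + 1 + d) 1"

definition minor :: "nat \<Rightarrow> nat \<Rightarrow> nat \<Rightarrow> (nat, 'a::comm_ring_1) mpoly" where
  "minor d j l = mvar (j + 1) * mvar (l + 1 + d) - mvar (l + 1) * mvar (j + 1 + d)"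

lemma minor_eq: "minor d j l = single (leading d j l) 1 - single (leading d l j) 1"
  by (simp add: minor_def leading_def mvar_def mult_single)

lemma catalecticant_minor_eq:
  assumes "j < l" "l < m"
  shows "catalecticant_minor m d (j, l) = minor d j l"
proof -
  let ?A = "catalecticant m d :: (nat, 'a) mpoly mat"
  let ?B = "submatrix ?A UNIV {j, l}"
  have dim: "dim_row ?A = 2" "dim_col ?A = m"
    by (simp_all add: catalecticant_def)
  have "{k. k < m \<and> k \<in> {j, l}} = {j, l}"
    using assms by auto
  then have B: "?B \<in> carrier_mat 2 2"
    using assms by (intro carrier_matI) (simp_all add: dim_submatrix dim)
  have idx: "{a. (a = j \<or> a = l) \<and> a < j} = {}" "{a. (a = j \<or> a = l) \<and> a < l} = {j}"
    using assms by auto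
  have entry: "?B $$ (i, 0) = ?A $$ (i, j)" "?B $$ (i, 1) = ?A $$ (i, l)" if "i < 2" for i
    using submatrix_index_card[of i ?A j UNIV "{j, l}"]
      submatrix_index_card[of i ?A l UNIV "{j, l}"] that assms
    by (simp_all add: dim idx)
  have "det ?B = ?A $$ (0, j) * ?A $$ (1, l) - ?A $$ (0, l) * ?A $$ (1, j)"
    by (simp add: det_two_by_two[OF B] entry entry[unfolded One_nat_def])
  then show ?thesis
    using assms by (simp add: catalecticant_minor_def catalecticant_def minor_def)
qed

text \<open>The indeterminate \<open>T\<^sub>j\<^sub>l\<close> extended antisymmetrically to all pairs of columns. In the shifted relation
  below the order of some pairs of columns depends on \<open>d\<close>, and this extension avoids distinguishing cases.\<close>

definition minor_var :: "nat \<Rightarrow> nat \<Rightarrow> (nat \<times> nat, 'a::comm_ring_1) mpoly" where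
  "minor_var j l = (if j < l then mvar (j, l) else if l < j then - mvar (l, j) else 0)"

text \<open>The derivative of \<open>T\<^sub>j\<^sub>l\<close> with respect to \<open>T\<^sub>k\<close>, as a constant polynomial.\<close>

definition minor_var_sign :: "nat \<times> nat \<Rightarrow> nat \<Rightarrow> nat \<Rightarrow> ('x, 'a::comm_ring_1) mpoly" where
  "minor_var_sign k j l = (if k = (j, l) \<and> j < l then 1 else if k = (l, j) \<and> l < j then - 1 else 0)"

lemma finite_minor_indices: "finite (minor_indices m)"
  by (rule finite_subset[of _ "{..<m} \<times> {..<m}"]) (auto simp: minor_indices_def)

lemma minor_in_poly_ring: "j < m \<Longrightarrow> l < m \<Longrightarrow> minor d j l \<in> poly_ring {1..m + d}"
  by (auto simp: minor_def intro!: poly_ring_diff poly_ring_mult poly_ring_mvar)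

lemma catalecticant_minor_in_poly_ring:
  "k \<in> minor_indices m \<Longrightarrow> catalecticant_minor m d k \<in> poly_ring {1..m + d}"
  by (auto simp: minor_indices_def catalecticant_minor_eq simp del: One_nat_def
      intro!: minor_in_poly_ring)

lemma minor_var_in_poly_ring: "j < m \<Longrightarrow> l < m \<Longrightarrow> minor_var j l \<in> poly_ring (minor_indices m)"
  by (auto simp: minor_var_def minor_indices_def intro!: poly_ring_mvar poly_ring_uminus)

lemma msubst_minor_var:
  "j < m \<Longrightarrow> l < m \<Longrightarrow> msubst (catalecticant_minor m d) (minor_var j l) = minor d j l"
  by (auto simp: minor_var_def msubst_uminus catalecticant_minor_eq) (auto simp: minor_def)

lemma msubst_mpderiv_minor_var:
  "msubst f (mpderiv k (minor_var j l)) = minor_var_sign k j l"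
  by (auto simp: minor_var_def minor_var_sign_def mpderiv_mvar mpderiv_uminus msubst_uminus)

text \<open>The \<open>dT\<^sub>k\<close>-component of the differential of \<open>T\<^sub>a\<^sub>b T\<^sub>c\<^sub>e\<close> after substitution of the minors.\<close>

definition polar_product :: "nat \<Rightarrow> nat \<Rightarrow> nat \<Rightarrow> nat \<Rightarrow> nat \<Rightarrow> nat \<times> nat \<Rightarrow> (nat, 'a::comm_ring_1) mpoly" where
  "polar_product d a b c e k =
    minor_var_sign k a b * minor d c e + minor d a b * minor_var_sign k c e"

lemma msubst_mpderiv_minor_var_mult:
  assumes "a < m" "b < m" "c < m" "e < m"
  shows "msubst (catalecticant_minor m d) (mpderiv k (minor_var a b * minor_var c e)) =
    polar_product d a b c e k"
  using assms
  by (simp add: mpderiv_mult msubst_add msubst_mult msubst_minor_var msubst_mpderiv_minor_var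
      polar_product_def)

text \<open>For \<open>a < b < c < e\<close> the last product has the smallest leading monomial, and the first two products
  share theirs.\<close>

lemma plucker_relation:
  assumes "a < m" "b < m" "c < m" "e < m"
  shows "minor_var b c * minor_var a e - minor_var a c * minor_var b e
      + minor_var a b * minor_var c e
    \<in> polynomial_relations (minor_indices m)
      (catalecticant_minor m d :: _ \<Rightarrow> (nat, 'a::comm_ring_1) mpoly)"
  unfolding polynomial_relations_def using assms
  by (auto intro!: poly_ring_add poly_ring_diff poly_ring_mult minor_var_in_poly_ring
      simp: msubst_add msubst_diff msubst_mult msubst_minor_var)
    (simp add: minor_def algebra_simps)

text \<open>Number the indeterminates from 0 like the columns, so that column \<open>j\<close> is
  \<open>X\<^sub>j = (x\<^sub>j, x\<^sub>j\<^sub>+\<^sub>d)\<close>. For vectors \<open>U = (U\<^sub>1, U\<^sub>2)\<close> and \<open>V = (V\<^sub>1, V\<^sub>2)\<close>, expanding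
  \<open>Q(U, V) = det(U, X\<^sub>b) det(X\<^sub>c\<^sub>+\<^sub>d, V) - det(U, X\<^sub>c) det(X\<^sub>b\<^sub>+\<^sub>d, V)\<close> gives
  \<open>- U\<^sub>1 V\<^sub>1 [b+d,c+d] - U\<^sub>2 V\<^sub>2 [b,c] + U\<^sub>2 V\<^sub>1 ([b,c+d] - [c,b+d])\<close>: the coefficient of \<open>U\<^sub>1 V\<^sub>2\<close> vanishes
  because the second row is a shift of the first. The relation is this identity for
  \<open>Q(X\<^sub>a, X\<^sub>e\<^sub>+\<^sub>d) - Q(X\<^sub>a\<^sub>+\<^sub>d, X\<^sub>e)\<close>, in which \<open>U\<^sub>1 V\<^sub>1\<close>, \<open>U\<^sub>2 V\<^sub>2\<close> and \<open>U\<^sub>2 V\<^sub>1\<close> change by the minors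
  \<open>[a,e]\<close>, \<open>[a+d,e+d]\<close> and \<open>[a+d,e]\<close>. For \<open>a < b < c < e\<close> the first two products share the
  largest leading monomial, and from the fourth product on \<open>x\<^sub>a\<close> no longer occurs.\<close>

lemma shifted_plucker_relation:
  assumes "a + d < m" "b + d < m" "c + d < m" "e + d < m"
  shows "minor_var a b * minor_var (c + d) (e + d) - minor_var a c * minor_var (b + d) (e + d)
      + minor_var a e * minor_var (b + d) (c + d) + minor_var (a + d) (e + d) * minor_var b c
      - minor_var (a + d) e * minor_var b (c + d) + minor_var (a + d) e * minor_var c (b + d)
      - minor_var (a + d) b * minor_var (c + d) e + minor_var (a + d) c * minor_var (b + d) e
    \<in> polynomial_relations (minor_indices m)
      (catalecticant_minor m d :: _ \<Rightarrow> (nat, 'a::comm_ring_1) mpoly)"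
  unfolding polynomial_relations_def using assms
  by (auto intro!: poly_ring_add poly_ring_diff poly_ring_mult minor_var_in_poly_ring
      simp: msubst_add msubst_diff msubst_mult msubst_minor_var)
    (simp add: minor_def algebra_simps)

section \<open>Weights\<close>

text \<open>Base 5 makes one indeterminate outweigh any product of four later ones, which is all that
  comparing products of two minors requires.\<close>

definition var_weight :: "nat \<Rightarrow> nat \<Rightarrow> nat" where
  "var_weight n i = 5 ^ (n - i)"

definition weight :: "nat \<Rightarrow> (nat \<Rightarrow>\<^sub>0 nat) \<Rightarrow> nat" where
  "weight n u = (\<Sum>i \<le> n. lookup u i * var_weight n i)"

lemma weight_add: "weight n (u + v) = weight n u + weight n v"
  by (simp add: weight_def lookup_add distrib_right sum.distrib)

lemma weight_single:
  assumes "i \<le> n"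
  shows "weight n (single i 1) = var_weight n i"
proof -
  have "weight n (single i 1) = (\<Sum>j \<le> n. if j = i then var_weight n i else 0)"
    unfolding weight_def by (intro sum.cong) (auto simp: lookup_single when_def)
  then show ?thesis using assms by simp
qed

lemma weight_leading:
  "j + 1 \<le> n \<Longrightarrow> l + 1 + d \<le> n \<Longrightarrow>
    weight n (leading d j l) = var_weight n (j + 1) + var_weight n (l + 1 + d)"
  unfolding leading_def weight_add by (simp only: weight_single)

lemma var_weight_antimono: "i \<le> j \<Longrightarrow> var_weight n j \<le> var_weight n i"
  by (simp add: var_weight_def power_increasing)

lemma var_weight_Suc: "i < n \<Longrightarrow> var_weight n i = 5 * var_weight n (i + 1)"
  by (simp add: var_weight_def Suc_diff_Suc flip: power_Suc)

lemma var_weight_pos: "0 < var_weight n i"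
  by (simp add: var_weight_def)

text \<open>Of the two monomials of a minor, only the leading one contains the first indeterminate \<open>x\<^sub>j\<^sub>+\<^sub>1\<close>.\<close>

lemma weight_leading_swap:
  assumes "1 \<le> d" "j < l" "l < n" "l + d < n"
  shows "weight n (leading d l j) < weight n (leading d j l)"
proof -
  have "weight n (leading d l j) \<le> var_weight n (j + 2) + var_weight n (j + 2)"
    using assms by (subst weight_leading) (auto intro!: add_mono var_weight_antimono)
  also have "\<dots> < var_weight n (j + 1)"
    using var_weight_Suc[of "j + 1" n] var_weight_pos[of n "j + 2"] assms by simp
  also have "\<dots> \<le> weight n (leading d j l)"
    using assms by (subst weight_leading) auto
  finally show ?thesis .
qed

section \<open>Leading parts of vectors\<close>

definition weight_below :: "nat \<Rightarrow> nat \<Rightarrow> (nat, 'a::comm_ring_1) mpoly \<Rightarrow> bool" where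
  "weight_below n w p \<longleftrightarrow> (\<forall>u \<in> keys p. weight n u < w)"

lemma weight_below_0 [simp]: "weight_below n w 0"
  by (simp add: weight_below_def)

lemma weight_below_single: "weight n u < w \<Longrightarrow> weight_below n w (single u a)"
  by (simp add: weight_below_def)

lemma weight_below_add: "weight_below n w p \<Longrightarrow> weight_below n w q \<Longrightarrow> weight_below n w (p + q)"
  using keys_add[of p q] by (auto simp: weight_below_def)

lemma weight_below_diff: "weight_below n w p \<Longrightarrow> weight_below n w q \<Longrightarrow> weight_below n w (p - q)"
  using keys_diff_subset[of p q] by (auto simp: weight_below_def)

lemma weight_below_scalar: "weight_below n w p \<Longrightarrow> weight_below n w (p * single 0 a)"
  by (auto simp: weight_below_def elim!: keys_mult_single)

text \<open>The vector \<open>q\<close> has multidegree \<open>\<mu>\<close> with coefficients \<open>c\<close>, up to terms of smaller weight.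
  Multiplying the \<open>dT\<^sub>j\<^sub>l\<close>-component by the leading monomial of the minor turns multidegrees into
  exponents, so that no monomial has to be divided by another.\<close>

definition has_leading_weighting ::
  "nat \<Rightarrow> nat \<Rightarrow> (nat \<Rightarrow>\<^sub>0 nat) \<Rightarrow> (nat \<times> nat \<Rightarrow> (nat, 'a::comm_ring_1) mpoly) \<Rightarrow> (nat \<times> nat \<Rightarrow> 'a) \<Rightarrow> bool"
where
  "has_leading_weighting m d \<mu> q c \<longleftrightarrow> (\<forall>(j, l) \<in> minor_indices m.
    weight_below (m + d) (weight (m + d) \<mu>) (q (j, l) * single (leading d j l) 1 - single \<mu> (c (j, l))))"

lemma has_leading_weighting_add:
  assumes "has_leading_weighting m d \<mu> q c" "has_leading_weighting m d \<mu> q' c'"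
  shows "has_leading_weighting m d \<mu> (\<lambda>k. q k + q' k) (\<lambda>k. c k + c' k)"
  unfolding has_leading_weighting_def
proof (intro ballI, clarify)
  fix j l assume "(j, l) \<in> minor_indices m"
  then have "weight_below (m + d) (weight (m + d) \<mu>)
      ((q (j, l) * single (leading d j l) 1 - single \<mu> (c (j, l))) +
       (q' (j, l) * single (leading d j l) 1 - single \<mu> (c' (j, l))))"
    using assms by (intro weight_below_add) (auto simp: has_leading_weighting_def)
  then show "weight_below (m + d) (weight (m + d) \<mu>)
      ((q (j, l) + q' (j, l)) * single (leading d j l) 1 - single \<mu> (c (j, l) + c' (j, l)))"
    by (simp add: single_add algebra_simps)
qed

lemma has_leading_weighting_scalar:
  assumes "has_leading_weighting m d \<mu> q c"
  shows "has_leading_weighting m d \<mu> (\<lambda>k. single 0 t * q k) (\<lambda>k. t * c k)"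
  unfolding has_leading_weighting_def
proof (intro ballI, clarify)
  fix j l assume "(j, l) \<in> minor_indices m"
  then have "weight_below (m + d) (weight (m + d) \<mu>)
      ((q (j, l) * single (leading d j l) 1 - single \<mu> (c (j, l))) * single 0 t)"
    using assms by (intro weight_below_scalar) (auto simp: has_leading_weighting_def)
  moreover have "single \<mu> (c (j, l)) * single 0 t = single \<mu> (t * c (j, l))"
    by (simp add: mult_single mult.commute)
  ultimately show "weight_below (m + d) (weight (m + d) \<mu>)
      (single 0 t * q (j, l) * single (leading d j l) 1 - single \<mu> (t * c (j, l)))"
    by (simp add: algebra_simps)
qed

lemma has_leading_weighting_diff:
  assumes "has_leading_weighting m d \<mu> q c" "has_leading_weighting m d \<mu> q' c'"
  shows "has_leading_weighting m d \<mu> (\<lambda>k. q k - q' k) (\<lambda>k. c k - c' k)"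
proof -
  have "single 0 (- 1) = (- 1 :: (nat, 'a) mpoly)"
    by (simp add: single_uminus)
  then show ?thesis
    using has_leading_weighting_add[OF assms(1) has_leading_weighting_scalar[OF assms(2), of "- 1"]]
    by simp
qed

text \<open>Only the component \<open>k = (a, b)\<close> is nonzero. There the leading monomial of the minor on
  \<open>c, e\<close> gives \<open>\<mu>\<close>, and the other one has smaller weight.\<close>

lemma has_leading_weighting_half_product:
  assumes "1 \<le> d" "a < b" "b < m" "c < e" "e < m"
    and \<mu>: "\<mu> = \<nu> + (leading d a b + leading d c e)"
  shows "has_leading_weighting m d \<mu>
    (\<lambda>k. single \<nu> 1 * (minor_var_sign k a b * minor d c e)) (edge (a, b))"
  unfolding has_leading_weighting_def
proof (intro ballI, clarify)
  fix j l
  have "weight (m + d) (leading d e c) < weight (m + d) (leading d c e)"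
    using assms by (intro weight_leading_swap) auto
  then have "weight (m + d) (\<nu> + leading d e c + leading d a b) < weight (m + d) \<mu>"
    by (simp add: weight_add \<mu>)
  moreover have "single \<nu> 1 * (minor_var_sign (j, l) a b * minor d c e) * single (leading d j l) 1
      - single \<mu> (edge (a, b) (j, l)) =
    single (\<nu> + leading d e c + leading d a b)
      (if (j, l) = (a, b) then - 1 else 0 :: 'a)"
    using \<open>a < b\<close>
    by (auto simp: minor_var_sign_def edge_def minor_eq mult_single algebra_simps \<mu> single_uminus)
  ultimately show "weight_below (m + d) (weight (m + d) \<mu>)
    (single \<nu> 1 * (minor_var_sign (j, l) a b * minor d c e) * single (leading d j l) 1
      - single \<mu> (edge (a, b) (j, l)) :: (nat, 'a) mpoly)"
    by (simp add: weight_below_single)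
qed

lemma has_leading_weighting_product:
  assumes "1 \<le> d" "a < b" "b < m" "c < e" "e < m"
    and \<mu>: "\<mu> = \<nu> + (leading d a b + leading d c e)"
  shows "has_leading_weighting m d \<mu> (\<lambda>k. single \<nu> 1 * polar_product d a b c e k)
    (\<lambda>k. edge (a, b) k + edge (c, e) k)"
proof -
  have "\<mu> = \<nu> + (leading d c e + leading d a b)"
    by (simp add: \<mu> add.commute)
  then have "has_leading_weighting m d \<mu>
      (\<lambda>k. single \<nu> 1 * (minor_var_sign k c e * minor d a b)) (edge (c, e))"
    using assms by (intro has_leading_weighting_half_product)
  from has_leading_weighting_add[OF has_leading_weighting_half_product[OF assms] this]
  show ?thesis
    by (simp add: polar_product_def algebra_simps)
qed

text \<open>The weight of the leading monomial of the minor on two columns in either order.\<close>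

definition top_weight :: "nat \<Rightarrow> nat \<Rightarrow> nat \<Rightarrow> nat \<Rightarrow> nat" where
  "top_weight n d j l = weight n (leading d (min j l) (max j l))"

lemma weight_le_top_weight:
  assumes "1 \<le> d" "j + d < n" "l + d < n"
  shows "weight n (leading d j l) \<le> top_weight n d j l"
  using weight_leading_swap[of d l j n] assms
  by (cases "j \<le> l") (auto simp: top_weight_def min_def max_def)

lemma top_weight_commute: "top_weight n d j l = top_weight n d l j"
  by (simp add: top_weight_def min.commute max.commute)

lemma weight_below_lower_half_product:
  assumes "1 \<le> d" "a < m" "b < m" "c < m" "e < m"
    and w: "weight (m + d) \<nu> + top_weight (m + d) d a b + top_weight (m + d) d c e < w"
  shows "weight_below (m + d) w
    (single \<nu> 1 * (minor_var_sign (j, l) a b * minor d c e) * single (leading d j l) 1)"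
proof (cases "minor_var_sign (j, l) a b = (0 :: (nat, 'a) mpoly)")
  case True
  show ?thesis unfolding True by simp
next
  case False
  define s :: 'a where "s = (if a < b then 1 else - 1)"
  have s: "minor_var_sign (j, l) a b = (single 0 s :: (nat, 'a) mpoly)"
    and jl: "j = min a b" "l = max a b"
    using False by (auto simp: minor_var_sign_def s_def single_uminus split: if_splits)
  have "weight (m + d) (leading d c e) \<le> top_weight (m + d) d c e"
    "weight (m + d) (leading d e c) \<le> top_weight (m + d) d c e"
    using weight_le_top_weight[of d c "m + d" e] weight_le_top_weight[of d e "m + d" c] assms
    by (simp_all add: top_weight_commute[of _ d e])
  then have "weight_below (m + d) w
    (single (\<nu> + leading d c e + leading d j l) s - single (\<nu> + leading d e c + leading d j l) s)"
    using w by (intro weight_below_diff weight_below_single)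
      (simp_all add: weight_add top_weight_def jl)
  then show ?thesis
    by (simp add: s minor_eq mult_single algebra_simps)
qed

lemma has_leading_weighting_lower_product:
  assumes "1 \<le> d" "a < m" "b < m" "c < m" "e < m"
    and w: "weight (m + d) \<nu> + top_weight (m + d) d a b + top_weight (m + d) d c e < weight (m + d) \<mu>"
  shows "has_leading_weighting m d \<mu> (\<lambda>k. single \<nu> 1 * polar_product d a b c e k) (\<lambda>k. 0)"
  unfolding has_leading_weighting_def
proof (intro ballI, clarify)
  fix j l
  have "weight_below (m + d) (weight (m + d) \<mu>)
    (single \<nu> 1 * (minor_var_sign (j, l) a b * minor d c e) * single (leading d j l) 1 +
     single \<nu> 1 * (minor_var_sign (j, l) c e * minor d a b) * single (leading d j l) 1)"
    using assms by (intro weight_below_add weight_below_lower_half_product) auto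
  then show "weight_below (m + d) (weight (m + d) \<mu>)
    (single \<nu> 1 * polar_product d a b c e (j, l) * single (leading d j l) 1 - single \<mu> 0)"
    by (simp add: polar_product_def algebra_simps)
qed

lemma top_weight_le:
  assumes "p \<le> j" "p \<le> l" "j + d < n" "l + d < n"
  shows "top_weight n d j l \<le> 2 * var_weight n (p + 1)"
proof -
  have "top_weight n d j l \<le> var_weight n (p + 1) + var_weight n (p + 1)"
    unfolding top_weight_def using assms
    by (subst weight_leading) (auto intro!: add_mono var_weight_antimono)
  then show ?thesis by simp
qed

lemma top_weight_eq:
  assumes "j < l" "l + d < n"
  shows "top_weight n d j l = var_weight n (j + 1) + var_weight n (l + 1 + d)"
  using assms by (simp add: top_weight_def min_def max_def weight_leading)

lemma two_var_weights_less:
  assumes "p < i" "p < j" "p < n"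
  shows "var_weight n i + var_weight n j < var_weight n p"
  using var_weight_antimono[of "p + 1" i n] var_weight_antimono[of "p + 1" j n]
    var_weight_Suc[of p n] var_weight_pos[of n "p + 1"] assms by simp

text \<open>In terms of vertices, both sides share \<open>a\<close> and \<open>e + d\<close>; the lower side has two further vertices
  after \<open>b\<close>, the other side has \<open>b\<close> itself.\<close>

lemma weight_lower_plucker_term:
  assumes "1 \<le> d" "a < b" "b < c" "c < e" "e < m"
  shows "top_weight (m + d) d a b + top_weight (m + d) d c e
    < weight (m + d) (leading d b c + leading d a e)"
  using two_var_weights_less[of "b + 1" "b + 1 + d" "c + 1" "m + d"]
    var_weight_pos[of "m + d" "c + 1 + d"] assms
  by (simp add: top_weight_eq weight_add weight_leading del: One_nat_def)

text \<open>The vertices \<open>a\<close> and \<open>b + d\<close> cancel, which leaves two vertices after \<open>c + d\<close> on the lower side.\<close>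

lemma weight_lower_shifted_term:
  assumes "1 \<le> d" "a < b" "b < c" "c < e" "e + d < m"
  shows "top_weight (m + d) d a e + top_weight (m + d) d (b + d) (c + d)
    < weight (m + d) (leading d a b + leading d (c + d) (e + d))"
  using two_var_weights_less[of "c + d + 1" "c + d + 1 + d" "e + 1 + d" "m + d"]
    var_weight_pos[of "m + d" "e + d + 1 + d"] assms
  by (simp add: top_weight_eq weight_add weight_leading add_ac del: One_nat_def)

text \<open>All four vertices on the lower side come after \<open>a\<close>.\<close>

lemma weight_right_shifted_term:
  assumes "a < b" "b < m"
    and "a < i" "a < j" "a < k" "a < l" "i < m" "j < m" "k < m" "l < m"
  shows "top_weight (m + d) d i j + top_weight (m + d) d k l
    < weight (m + d) (leading d a b + u)"
  using top_weight_le[of "a + 1" i j d "m + d"] top_weight_le[of "a + 1" k l d "m + d"]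
    var_weight_Suc[of "a + 1" "m + d"] var_weight_pos[of "m + d" "a + 1 + 1"] assms
  by (simp add: weight_add weight_leading del: One_nat_def)

section \<open>Lifting the 4-cycles to polar syzygies\<close>

definition polar_leading_weightings ::
  "nat \<Rightarrow> nat \<Rightarrow> (nat \<Rightarrow>\<^sub>0 nat) \<Rightarrow> (nat \<times> nat \<Rightarrow> 'a::comm_ring_1) set" where
  "polar_leading_weightings m d \<mu> =
    {c. \<exists>q \<in> polar_syzygies {1..m + d} (minor_indices m) (catalecticant_minor m d).
      has_leading_weighting m d \<mu> q c}"

lemma polar_leading_weightings_relationI:
  fixes F :: "(nat \<times> nat, 'a::comm_ring_1) mpoly"
  assumes F: "F \<in> polynomial_relations (minor_indices m) (catalecticant_minor m d)"
    and \<nu>: "keys \<nu> \<subseteq> {1..m + d}"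
    and F': "\<And>k. msubst (catalecticant_minor m d) (mpderiv k F) = p k"
    and lead: "has_leading_weighting m d \<mu> (\<lambda>k. single \<nu> 1 * p k) c"
  shows "c \<in> polar_leading_weightings m d \<mu>"
proof -
  have "(\<lambda>k. single \<nu> 1 * msubst (catalecticant_minor m d) (mpderiv k F))
    \<in> polar_syzygies {1..m + d} (minor_indices m) (catalecticant_minor m d)"
    unfolding polar_syzygies_def
    by (rule submodule_generated_smult_generator) (use F \<nu> in \<open>auto intro: poly_ring_single\<close>)
  then show ?thesis
    using lead by (auto simp: polar_leading_weightings_def F')
qed

lemma four_vars_dvd:
  assumes "{a, b, c, e} \<subseteq> keys \<mu>" "distinct [a, b, c, e]"
  obtains \<nu> :: "'x \<Rightarrow>\<^sub>0 nat"
  where "\<mu> = \<nu> + (single a 1 + single b 1 + (single c 1 + single e 1))" "keys \<nu> \<subseteq> keys \<mu>"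
proof
  let ?s = "single a 1 + single b 1 + (single c 1 + single e (1::nat))"
  show "\<mu> = \<mu> - ?s + ?s"
    using assms
    by (intro poly_mapping_eqI)
      (auto simp: lookup_add lookup_minus lookup_single when_def in_keys_iff)
  show "keys (\<mu> - ?s) \<subseteq> keys \<mu>"
    by (auto simp: in_keys_iff lookup_minus)
qed

text \<open>A monomial multiple of the polar syzygy of the Pluecker relation has the cycle as its leading part: the
  two products with the largest leading monomial contribute two edges each, and the third product
  contributes only smaller weights.\<close>

lemma nested_cycle_polar:
  assumes d: "1 \<le> d" and ord: "a < b" "b < c" "c < e"
    and \<mu>: "keys \<mu> \<subseteq> {1..m + d}" "{a + 1, b + 1, c + d + 1, e + d + 1} \<subseteq> keys \<mu>"
  shows "nested_cycle a b c e \<in> polar_leading_weightings m d \<mu>"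
proof -
  have e: "e < m" using \<mu> by auto
  have "distinct [b + 1, c + 1 + d, a + 1, e + 1 + d]"
    using d ord by auto
  moreover have "{b + 1, c + 1 + d, a + 1, e + 1 + d} \<subseteq> keys \<mu>"
    using \<mu> by (simp add: add_ac)
  ultimately obtain \<nu> where \<nu>: "\<mu> = \<nu> + (leading d b c + leading d a e)" "keys \<nu> \<subseteq> keys \<mu>"
    unfolding leading_def by (metis four_vars_dvd)
  have \<nu>': "\<mu> = \<nu> + (leading d a c + leading d b e)"
    unfolding \<nu> by (simp add: leading_def add_ac)
  show ?thesis
  proof (rule polar_leading_weightings_relationI[OF plucker_relation[of a m b c e d]])
    show "has_leading_weighting m d \<mu>
      (\<lambda>k. single \<nu> 1 * (polar_product d b c a e k - polar_product d a c b e k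
        + polar_product d a b c e k)) (nested_cycle a b c e)"
    proof -
      have "has_leading_weighting m d \<mu>
        (\<lambda>k. single \<nu> 1 * polar_product d b c a e k - single \<nu> 1 * polar_product d a c b e k
          + single \<nu> 1 * polar_product d a b c e k)
        (\<lambda>k. edge (b, c) k + edge (a, e) k - (edge (a, c) k + edge (b, e) k) + 0)"
        using d ord e \<nu>(1) \<nu>' weight_lower_plucker_term[OF d ord e]
        by (intro has_leading_weighting_add has_leading_weighting_diff
            has_leading_weighting_product has_leading_weighting_lower_product)
          (auto simp: weight_add)
      then show ?thesis
        by (simp add: nested_cycle_def algebra_simps)
    qed
  qed (use ord e \<nu> \<mu> in \<open>auto simp: mpderiv_add mpderiv_diff msubst_add msubst_diff
      msubst_mpderiv_minor_var_mult\<close>)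
qed

text \<open>The same argument with the shifted relation, in which all but the first two products have smaller weight.\<close>

lemma disjoint_cycle_polar:
  assumes d: "1 \<le> d" and ord: "a < b" "b < c" "c < e"
    and \<mu>: "keys \<mu> \<subseteq> {1..m + d}" "{a + 1, b + d + 1, c + d + 1, e + 2 * d + 1} \<subseteq> keys \<mu>"
  shows "disjoint_cycle d a b c e \<in> polar_leading_weightings m d \<mu>"
proof -
  have e: "e + d < m" using \<mu> by auto
  have "distinct [a + 1, b + 1 + d, c + d + 1, e + d + 1 + d]"
    using d ord by auto
  moreover have "{a + 1, b + 1 + d, c + d + 1, e + d + 1 + d} \<subseteq> keys \<mu>"
    using \<mu> by (simp add: add_ac mult_2)
  ultimately obtain \<nu>
    where \<nu>: "\<mu> = \<nu> + (leading d a b + leading d (c + d) (e + d))" "keys \<nu> \<subseteq> keys \<mu>"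
    unfolding leading_def by (metis four_vars_dvd)
  have \<nu>': "\<mu> = \<nu> + (leading d a c + leading d (b + d) (e + d))"
    unfolding \<nu> by (simp add: leading_def add_ac)
  have right: "top_weight (m + d) d i j + top_weight (m + d) d k l
      < weight (m + d) (leading d a b + leading d (c + d) (e + d))"
    if "a < i" "a < j" "a < k" "a < l" "i < m" "j < m" "k < m" "l < m" for i j k l
    using that ord e by (intro weight_right_shifted_term) auto
  show ?thesis
  proof (rule polar_leading_weightings_relationI[OF shifted_plucker_relation[of a d m b c e]])
    show "has_leading_weighting m d \<mu>
      (\<lambda>k. single \<nu> 1 * (polar_product d a b (c + d) (e + d) k - polar_product d a c (b + d) (e + d) k
        + polar_product d a e (b + d) (c + d) k + polar_product d (a + d) (e + d) b c k
        - polar_product d (a + d) e b (c + d) k + polar_product d (a + d) e c (b + d) k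
        - polar_product d (a + d) b (c + d) e k + polar_product d (a + d) c (b + d) e k))
      (disjoint_cycle d a b c e)"
    proof -
      have "has_leading_weighting m d \<mu>
        (\<lambda>k. single \<nu> 1 * polar_product d a b (c + d) (e + d) k
          - single \<nu> 1 * polar_product d a c (b + d) (e + d) k
          + single \<nu> 1 * polar_product d a e (b + d) (c + d) k
          + single \<nu> 1 * polar_product d (a + d) (e + d) b c k
          - single \<nu> 1 * polar_product d (a + d) e b (c + d) k
          + single \<nu> 1 * polar_product d (a + d) e c (b + d) k
          - single \<nu> 1 * polar_product d (a + d) b (c + d) e k
          + single \<nu> 1 * polar_product d (a + d) c (b + d) e k)
        (\<lambda>k. edge (a, b) k + edge (c + d, e + d) k - (edge (a, c) k + edge (b + d, e + d) k)
          + 0 + 0 - 0 + 0 - 0 + 0)"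
        using d ord e weight_lower_shifted_term[OF d ord e]
        apply (intro has_leading_weighting_add has_leading_weighting_diff)
        subgoal by (intro has_leading_weighting_product \<nu>(1)) auto
        subgoal by (intro has_leading_weighting_product \<nu>') auto
        subgoal by (intro has_leading_weighting_lower_product) (auto simp: \<nu>(1) weight_add)
        subgoal using right[of "a + d" "e + d" b c]
          by (intro has_leading_weighting_lower_product) (auto simp: \<nu>(1) weight_add)
        subgoal using right[of "a + d" e b "c + d"]
          by (intro has_leading_weighting_lower_product) (auto simp: \<nu>(1) weight_add)
        subgoal using right[of "a + d" e c "b + d"]
          by (intro has_leading_weighting_lower_product) (auto simp: \<nu>(1) weight_add)
        subgoal using right[of "a + d" b "c + d" e]
          by (intro has_leading_weighting_lower_product) (auto simp: \<nu>(1) weight_add)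
        subgoal using right[of "a + d" c "b + d" e]
          by (intro has_leading_weighting_lower_product) (auto simp: \<nu>(1) weight_add)
        done
      then show ?thesis
        by (simp add: disjoint_cycle_def algebra_simps)
    qed
  qed (use ord e \<nu> \<mu> in \<open>auto simp: mpderiv_add mpderiv_diff msubst_add msubst_diff
      msubst_mpderiv_minor_var_mult\<close>)
qed

section \<open>Leading terms of differential syzygies\<close>

definition multidegrees ::
  "nat \<Rightarrow> nat \<Rightarrow> (nat \<times> nat \<Rightarrow> (nat, 'a::comm_ring_1) mpoly) \<Rightarrow> (nat \<Rightarrow>\<^sub>0 nat) set" where
  "multidegrees m d z = (\<Union>(j, l) \<in> minor_indices m. keys (z (j, l) * single (leading d j l) 1))"

lemma finite_multidegrees: "finite (multidegrees m d z)"
  by (auto simp: multidegrees_def finite_minor_indices)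

definition leading_weighting ::
  "nat \<Rightarrow> nat \<Rightarrow> (nat \<Rightarrow>\<^sub>0 nat) \<Rightarrow> (nat \<times> nat \<Rightarrow> (nat, 'a::comm_ring_1) mpoly) \<Rightarrow> nat \<times> nat \<Rightarrow> 'a" where
  "leading_weighting m d \<mu> z = (\<lambda>(j, l). if (j, l) \<in> minor_indices m
    then lookup (z (j, l) * single (leading d j l) 1) \<mu> else 0)"

lemma multidegrees_subset:
  assumes "z \<in> free_module {1..m + d} (minor_indices m)" "\<mu> \<in> multidegrees m d z"
  shows "keys \<mu> \<subseteq> {1..m + d}"
proof -
  obtain j l where jl: "j < l" "l < m" "(j, l) \<in> minor_indices m"
    "\<mu> \<in> keys (z (j, l) * single (leading d j l) 1)"
    using assms(2) by (auto simp: multidegrees_def minor_indices_def)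
  have "z (j, l) \<in> poly_ring {1..m + d}"
    using assms(1) jl by (auto simp: free_module_def)
  moreover have "single (leading d j l) (1 :: 'a) \<in> poly_ring {1..m + d}"
    using jl keys_add[of "single (j + 1) (1::nat)" "single (l + 1 + d) 1"]
    by (intro poly_ring_single) (auto simp: leading_def)
  ultimately show ?thesis
    using poly_ring_mult jl(4) unfolding poly_ring_def by blast
qed

lemma lookup_leading:
  assumes "1 \<le> d" "j < l"
  shows "lookup (leading d j l) (x + 1) = (if j = x then 1 else 0) + (if l + d = x then 1 else 0)"
  using assms by (auto simp: leading_def lookup_add lookup_single when_def)

lemma leading_weighting_supp:
  assumes d: "1 \<le> d" and c: "leading_weighting m d \<mu> z e \<noteq> 0"
  shows "e \<in> edges_on d {i. i + 1 \<in> keys \<mu>}"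
proof -
  obtain j l where e: "e = (j, l)" by force
  have jl: "j < l" "\<mu> \<in> keys (z (j, l) * single (leading d j l) 1)"
    using c by (auto simp: e leading_weighting_def minor_indices_def in_keys_iff split: if_splits)
  obtain t where "\<mu> = t + leading d j l"
    using keys_mult_single[OF jl(2)] by metis
  then show ?thesis
    using jl d by (auto simp: e edges_on_def in_keys_iff lookup_add leading_def)
qed

text \<open>Multiply the syzygy equation for \<open>x\<close> by the indeterminate itself, so that Euler's operator acts on
  the minors, and compare coefficients at \<open>\<mu>\<close>. Leading monomials contribute the vertex sum. A contribution from
  the other monomial of a minor would come from a term of the syzygy whose multidegree outweighs \<open>\<mu>\<close>.\<close>

lemma leading_weighting_zero_sum:
  assumes d: "1 \<le> d"
    and z: "z \<in> differential_syzygies {1..m + d} (minor_indices m)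
      (catalecticant_minor m d :: _ \<Rightarrow> (nat, 'a::comm_ring_1) mpoly)"
    and \<mu>: "keys \<mu> \<subseteq> {1..m + d}"
    and top: "\<And>u. u \<in> multidegrees m d z \<Longrightarrow> weight (m + d) u \<le> weight (m + d) \<mu>"
  shows "vertex_sum d {i. i + 1 \<in> keys \<mu>} (leading_weighting m d \<mu> z) x = 0"
proof -
  let ?A = "{i. i + 1 \<in> keys \<mu>}"
  let ?c = "leading_weighting m d \<mu> z"
  let ?w = "\<lambda>(j, l). ((if j = x then 1 else 0) + (if l + d = x then 1 else 0)) * ?c (j, l)"
  have edges: "edges_on d ?A \<subseteq> minor_indices m"
    using \<mu> by (auto simp: edges_on_def minor_indices_def)
  have "?w e = 0" if "e \<in> minor_indices m - edges_on d ?A" for e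
  proof -
    have "?c e = 0"
      using that leading_weighting_supp[OF d, of m \<mu> z e] by blast
    then show ?thesis by (cases e) simp
  qed
  then have vs: "vertex_sum d ?A ?c x = sum ?w (minor_indices m)"
    unfolding vertex_sum_def
    by (intro sum.mono_neutral_left) (use edges finite_minor_indices in auto)
  show ?thesis
  proof (cases "x + 1 \<in> {1..m + d}")
    case False
    then show ?thesis
      unfolding vs by (intro sum.neutral) (auto simp: minor_indices_def)
  next
    case True
    have coeff: "lookup (mvar (x + 1) * (z e * mpderiv (x + 1) (catalecticant_minor m d e))) \<mu> = ?w e"
      if e: "e \<in> minor_indices m" for e
    proof -
      obtain j l where jl: "e = (j, l)" "j < l" "l < m"
        using e by (auto simp: minor_indices_def)
      let ?n = "lookup (leading d j l) (x + 1)" and ?n' = "lookup (leading d l j) (x + 1)"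
      have "mvar (x + 1) * (z e * mpderiv (x + 1) (catalecticant_minor m d e)) =
          z e * (mvar (x + 1) * mpderiv (x + 1) (single (leading d j l) 1)) -
          z e * (mvar (x + 1) * mpderiv (x + 1) (single (leading d l j) 1))"
        using jl by (simp add: catalecticant_minor_eq minor_eq mpderiv_diff algebra_simps)
      also have "\<dots> = z e * single (leading d j l) (of_nat ?n) - z e * single (leading d l j) (of_nat ?n')"
        by (simp only: mvar_mult_mpderiv_single mult_1_right)
      also have "single (leading d j l) (of_nat ?n) =
          single (leading d j l) (1 :: 'a) * single 0 (of_nat ?n)"
        by (simp only: mult_single add_0_right mult_1_left)
      finally have eq: "mvar (x + 1) * (z e * mpderiv (x + 1) (catalecticant_minor m d e)) =
          z e * single (leading d j l) 1 * single 0 (of_nat ?n)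
          - z e * single (leading d l j) (of_nat ?n')"
        by (simp only: mult.assoc)
      have "\<mu> \<notin> keys (z e * single (leading d l j) (of_nat ?n'))"
      proof
        assume "\<mu> \<in> keys (z e * single (leading d l j) (of_nat ?n'))"
        then obtain t where t: "t \<in> keys (z e)" "\<mu> = t + leading d l j"
          by (rule keys_mult_single)
        then have "t + leading d j l \<in> multidegrees m d z"
          using e lookup_mult_single[of "z e" "leading d j l" 1 t]
          by (auto simp: multidegrees_def jl in_keys_iff intro!: bexI[of _ "(j, l)"])
        then show False
          using top[of "t + leading d j l"] weight_leading_swap[of d j l "m + d"] jl d
          by (simp add: t weight_add)
      qed
      then have "lookup (mvar (x + 1) * (z e * mpderiv (x + 1) (catalecticant_minor m d e))) \<mu> =
          lookup (z e * single (leading d j l) 1) \<mu> * of_nat ?n"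
        unfolding eq lookup_minus lookup_mult_scalar by (simp add: in_keys_iff)
      also have "\<dots> = ?w e"
        unfolding lookup_leading[OF d jl(2)] using e jl(1) by (simp add: leading_weighting_def)
      finally show ?thesis .
    qed
    have "(\<Sum>e \<in> minor_indices m. z e * mpderiv (x + 1) (catalecticant_minor m d e)) = 0"
      using z True unfolding differential_syzygies_def by blast
    then have "lookup (\<Sum>e \<in> minor_indices m.
        mvar (x + 1) * (z e * mpderiv (x + 1) (catalecticant_minor m d e))) \<mu> = 0"
      by (simp flip: sum_distrib_left)
    moreover have "lookup (\<Sum>e \<in> minor_indices m.
        mvar (x + 1) * (z e * mpderiv (x + 1) (catalecticant_minor m d e))) \<mu> =
        sum ?w (minor_indices m)"
      unfolding lookup_sum by (rule sum.cong[OF refl coeff])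
    ultimately show ?thesis
      unfolding vs by simp
  qed
qed

lemma leading_weighting_polar:
  fixes z :: "nat \<times> nat \<Rightarrow> (nat, 'k::field_char_0) mpoly"
  assumes d: "1 \<le> d"
    and z: "z \<in> differential_syzygies {1..m + d} (minor_indices m) (catalecticant_minor m d)"
    and \<mu>: "\<mu> \<in> multidegrees m d z"
    and top: "\<And>u. u \<in> multidegrees m d z \<Longrightarrow> weight (m + d) u \<le> weight (m + d) \<mu>"
  shows "leading_weighting m d \<mu> z \<in> polar_leading_weightings m d \<mu>"
proof -
  let ?A = "{i. i + 1 \<in> keys \<mu>}"
  have keys: "keys \<mu> \<subseteq> {1..m + d}"
    using z \<mu> by (intro multidegrees_subset) (auto simp: differential_syzygies_def)
  interpret cycle_space d ?A "polar_leading_weightings m d \<mu> :: (nat \<times> nat \<Rightarrow> 'k) set"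
  proof
    show "finite ?A"
      using keys by (intro finite_subset[of ?A "{..m + d}"]) auto
    show "(\<lambda>e. 0) \<in> polar_leading_weightings m d \<mu>"
      unfolding polar_leading_weightings_def polar_syzygies_def
      by (intro CollectI bexI[OF _ submodule_generated_0]) (simp add: has_leading_weighting_def)
  next
    fix c c' :: "nat \<times> nat \<Rightarrow> 'k" and t
    assume "c \<in> polar_leading_weightings m d \<mu>" "c' \<in> polar_leading_weightings m d \<mu>"
    then obtain q q' where
      q: "q \<in> polar_syzygies {1..m + d} (minor_indices m) (catalecticant_minor m d)"
        "has_leading_weighting m d \<mu> q c"
      and q': "q' \<in> polar_syzygies {1..m + d} (minor_indices m) (catalecticant_minor m d)"
        "has_leading_weighting m d \<mu> q' c'"
      by (auto simp: polar_leading_weightings_def)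
    have "(\<lambda>k. q k + single 0 t * q' k)
        \<in> polar_syzygies {1..m + d} (minor_indices m) (catalecticant_minor m d)"
      using q(1) q'(1) unfolding polar_syzygies_def
      by (intro submodule_generated_add submodule_generated_smult poly_ring_single) auto
    then show "(\<lambda>e. c e + t * c' e) \<in> polar_leading_weightings m d \<mu>"
      using has_leading_weighting_add[OF q(2) has_leading_weighting_scalar[OF q'(2)]]
      by (auto simp: polar_leading_weightings_def)
  next
    fix a b c e :: nat
    assume "a < b" "b < c" "c < e" "{a, b, c + d, e + d} \<subseteq> ?A"
    then show "nested_cycle a b c e \<in> polar_leading_weightings m d \<mu>"
      using d keys by (intro nested_cycle_polar) auto
  next
    fix a b c e :: nat
    assume "a < b" "b < c" "c < e" "{a, b + d, c + d, e + 2 * d} \<subseteq> ?A"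
    then show "disjoint_cycle d a b c e \<in> polar_leading_weightings m d \<mu>"
      using d keys by (intro disjoint_cycle_polar) auto
  qed
  show ?thesis
    by (intro zero_sum_weighting_mem leading_weighting_supp[OF d]
        leading_weighting_zero_sum[OF d z keys top])
qed

lemma reduce_leading_multidegree:
  fixes z :: "nat \<times> nat \<Rightarrow> (nat, 'k::field_char_0) mpoly"
  assumes d: "1 \<le> d"
    and z: "z \<in> differential_syzygies {1..m + d} (minor_indices m) (catalecticant_minor m d)"
    and \<mu>: "\<mu> \<in> multidegrees m d z"
    and top: "\<And>u. u \<in> multidegrees m d z \<Longrightarrow> weight (m + d) u \<le> weight (m + d) \<mu>"
  obtains q where "q \<in> polar_syzygies {1..m + d} (minor_indices m) (catalecticant_minor m d)"
    and "multidegrees m d (\<lambda>k. z k - q k) \<subseteq>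
      (multidegrees m d z - {\<mu>}) \<union> {u. weight (m + d) u < weight (m + d) \<mu>}"
proof -
  obtain q where q: "q \<in> polar_syzygies {1..m + d} (minor_indices m) (catalecticant_minor m d)"
    and lead: "has_leading_weighting m d \<mu> q (leading_weighting m d \<mu> z)"
    using leading_weighting_polar[OF assms] by (auto simp: polar_leading_weightings_def)
  have "u \<in> (multidegrees m d z - {\<mu>}) \<union> {u. weight (m + d) u < weight (m + d) \<mu>}"
    if u: "u \<in> multidegrees m d (\<lambda>k. z k - q k)" for u
  proof -
    obtain j l where jl: "(j, l) \<in> minor_indices m"
      and u: "u \<in> keys ((z (j, l) - q (j, l)) * single (leading d j l) 1)"
      using u by (auto simp: multidegrees_def)
    define p where "p = z (j, l) * single (leading d j l) 1"
    define r where "r = q (j, l) * single (leading d j l) 1 - single \<mu> (leading_weighting m d \<mu> z (j, l))"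
    have "(z (j, l) - q (j, l)) * single (leading d j l) 1 = (p - single \<mu> (lookup p \<mu>)) - r"
      using jl by (simp add: p_def r_def leading_weighting_def algebra_simps)
    then have "u \<in> keys (p - single \<mu> (lookup p \<mu>)) \<or> u \<in> keys r"
      using u keys_diff_subset by (metis UnE subsetD)
    then show ?thesis
    proof
      assume "u \<in> keys (p - single \<mu> (lookup p \<mu>))"
      then have "u \<in> keys p" "u \<noteq> \<mu>"
        by (auto simp: in_keys_iff lookup_minus lookup_single when_def split: if_splits)
      then show ?thesis
        using jl by (auto simp: multidegrees_def p_def intro!: bexI[of _ "(j, l)"])
    next
      assume "u \<in> keys r"
      then show ?thesis
        using lead jl by (auto simp: has_leading_weighting_def weight_below_def r_def)
    qed
  qed
  then show ?thesis
    using that[OF q] by blast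
qed

lemma catalecticant_polar_syzygies_subset:
  "polar_syzygies {1..m + d} (minor_indices m) (catalecticant_minor m d)
    \<subseteq> differential_syzygies {1..m + d} (minor_indices m) (catalecticant_minor m d)"
  using finite_minor_indices catalecticant_minor_in_poly_ring
  by (rule polar_syzygies_subset_differential_syzygies)

text \<open>The number of multidegrees of a given weight is not controlled by the weight alone, so the induction
  on the weight bound contains an inner one on the number of multidegrees attaining it.\<close>

lemma syzygy_of_bounded_weight_polar:
  fixes z :: "nat \<times> nat \<Rightarrow> (nat, 'k::field_char_0) mpoly"
  assumes d: "1 \<le> d"
    and z: "z \<in> differential_syzygies {1..m + d} (minor_indices m) (catalecticant_minor m d)"
    and bound: "\<And>u. u \<in> multidegrees m d z \<Longrightarrow> weight (m + d) u < n"
  shows "z \<in> polar_syzygies {1..m + d} (minor_indices m) (catalecticant_minor m d)"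
  using z bound
proof (induction n arbitrary: z)
  case 0
  then have "multidegrees m d z = {}" by blast
  have "z (j, l) * single (leading d j l) 1 = 0" if "(j, l) \<in> minor_indices m" for j l
  proof -
    have "keys (z (j, l) * single (leading d j l) 1) \<subseteq> multidegrees m d z"
      using that unfolding multidegrees_def by blast
    then show ?thesis
      using \<open>multidegrees m d z = {}\<close> in_keys_iff by (intro poly_mapping_eqI) auto
  qed
  moreover have "single (leading d j l) (1 :: 'k) \<noteq> 0" for j l
    by (metis keys_single keys_zero insert_not_empty zero_neq_one)
  ultimately have "z k = 0" if "k \<in> minor_indices m" for k
    using that by (cases k) (metis mult_eq_0_iff)
  moreover have "z k = 0" if "k \<notin> minor_indices m" for k
    using 0(1) that unfolding differential_syzygies_def free_module_def by blast
  ultimately have "z k = 0" for k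
    by blast
  then have "z = (\<lambda>k. 0)" by (rule ext)
  then show ?case
    by (simp add: polar_syzygies_def submodule_generated_0)
next
  case (Suc n)
  note IH = Suc.IH
  show ?case
    using Suc.prems
  proof (induction "card {u \<in> multidegrees m d z. weight (m + d) u = n}"
      arbitrary: z rule: less_induct)
    case less
    let ?top = "\<lambda>z. {u \<in> multidegrees m d z. weight (m + d) u = n}"
    show ?case
    proof (cases "?top z = {}")
      case True
      then have "weight (m + d) u < n" if "u \<in> multidegrees m d z" for u
        using that less.prems(2)[OF that] by (auto simp: less_Suc_eq)
      then show ?thesis using IH less.prems(1) by blast
    next
      case False
      then obtain \<mu> where \<mu>: "\<mu> \<in> multidegrees m d z" "weight (m + d) \<mu> = n" by auto
      have "weight (m + d) u \<le> weight (m + d) \<mu>" if "u \<in> multidegrees m d z" for u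
        using less.prems(2)[OF that] \<mu>(2) by simp
      then obtain q
        where q: "q \<in> polar_syzygies {1..m + d} (minor_indices m) (catalecticant_minor m d)"
          and sub: "multidegrees m d (\<lambda>k. z k - q k) \<subseteq>
          (multidegrees m d z - {\<mu>}) \<union> {u. weight (m + d) u < weight (m + d) \<mu>}"
        by (rule reduce_leading_multidegree[OF d less.prems(1) \<mu>(1)])
      have "q \<in> differential_syzygies {1..m + d} (minor_indices m) (catalecticant_minor m d)"
        using q catalecticant_polar_syzygies_subset by blast
      then have diff: "(\<lambda>k. z k - q k)
          \<in> differential_syzygies {1..m + d} (minor_indices m) (catalecticant_minor m d)"
        using differential_syzygies_diff less.prems(1) by blast
      have "?top (\<lambda>k. z k - q k) \<subset> ?top z"
        using sub \<mu> by auto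
      then have "card (?top (\<lambda>k. z k - q k)) < card (?top z)"
        by (intro psubset_card_mono) (simp_all add: finite_multidegrees)
      moreover have "weight (m + d) u < Suc n" if "u \<in> multidegrees m d (\<lambda>k. z k - q k)" for u
        using that sub \<mu>(2) less.prems(2) by fastforce
      ultimately have "(\<lambda>k. z k - q k)
          \<in> polar_syzygies {1..m + d} (minor_indices m) (catalecticant_minor m d)"
        using less.hyps[OF _ diff] by blast
      from submodule_generated_add[OF this[unfolded polar_syzygies_def] q[unfolded polar_syzygies_def]]
      show ?thesis
        by (simp add: polar_syzygies_def)
    qed
  qed
qed

theorem proposition6p2:
  fixes m d :: nat
  assumes "1 \<le> d" and "d \<le> m"
  shows "polarizable {1..m + d} (minor_indices m)
    (catalecticant_minor m d :: nat \<times> nat \<Rightarrow> (nat, 'k::field_char_0) mpoly)"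
  unfolding polarizable_def
proof
  let ?f = "catalecticant_minor m d :: nat \<times> nat \<Rightarrow> (nat, 'k) mpoly"
  show "polar_syzygies {1..m + d} (minor_indices m) ?f \<subseteq>
      differential_syzygies {1..m + d} (minor_indices m) ?f"
    by (rule catalecticant_polar_syzygies_subset)
  show "differential_syzygies {1..m + d} (minor_indices m) ?f \<subseteq>
      polar_syzygies {1..m + d} (minor_indices m) ?f"
  proof
    fix z assume z: "z \<in> differential_syzygies {1..m + d} (minor_indices m) ?f"
    have "weight (m + d) u < Suc (Max (weight (m + d) ` multidegrees m d z))"
      if "u \<in> multidegrees m d z" for u
      using that finite_multidegrees[of m d z] by (simp add: less_Suc_eq_le)
    then show "z \<in> polar_syzygies {1..m + d} (minor_indices m) ?f"
      by (rule syzygy_of_bounded_weight_polar[OF assms(1) z])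
  qed
qed

end
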